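(* Let $X_1,X_2,\ldots$ be iid random variables with values in the ordered finite alphabet $\{\alpha_1<\cdots<\alpha_m\}$ with $\mathbb{P}(X_1=\alpha_r)=p_r$, $0<p_r<1$, $\sum_{r=1}^m p_r=1$, and let $p_{max}=\max_{1\le r\le m}p_r$. Let $LI_n$ be the length of the longest increasing subsequence of $X_1,\ldots,X_n$. Suppose that $p_{max}=p_{j_1}=p_{j_2}=\cdots=p_{j_k}$ for $1\le j_1<j_2<\cdots<j_k\le m$ and some $1\le k\le m$, and that $p_i<p_{max}$ otherwise. Then, as $n\to\infty$, $$\frac{LI_n-p_{max}n}{\sqrt n}\ \Rightarrow\ \sqrt{p_{max}}\left\{\frac{\sqrt{1-kp_{max}}-1}{k}\sum_{j=1}^k B^j(1)+\max_{0=t_0\le t_1\le\cdots\le t_{k-1}\le t_k=1}\ \sum_{\ell=1}^k\left[B^\ell(t_\ell)-B^\ell(t_{\ell-1})\right]\right\},$$ where $(B^1(t),B^2(t),\dots,B^k(t))$, $0\le t\le 1$, is a standard $k$-dimensional Brownian motion.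
   Context: Increasing subsequences are understood in the weak (nondecreasing) sense: $LI_n$ is the largest $\ell$ for which there are indices $1\le i_1<\cdots<i_\ell\le n$ with $X_{i_1}\le\cdots\le X_{i_\ell}$. The symbol $\Rightarrow$ denotes convergence in distribution. A standard $k$-dimensional Brownian motion consists of $k$ independent standard one-dimensional Brownian motions started at $0$. *)

theory Defs
  imports "HOL-Probability.Probability"
begin

(* Only the values x 1, ..., x n (one-based) are read; l = 0 is always admissible. *)
definition longest_increasing :: "(nat \<Rightarrow> 'c::linorder) \<Rightarrow> nat \<Rightarrow> nat" where
  "longest_increasing x n =
     Max {l. \<exists>i. strict_mono_on {1..l} i \<and> i ` {1..l} \<subseteq> {1..n} \<and> mono_on {1..l} (\<lambda>a. x (i a))}"

(* Every path, not just almost every path, is continuous and starts at 0. This keeps path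
   functionals such as max_increments below measurable without completing M. *)
definition standard_brownian_motion :: "'b measure \<Rightarrow> (real \<Rightarrow> 'b \<Rightarrow> real) \<Rightarrow> bool" where
  "standard_brownian_motion M W \<longleftrightarrow>
     (\<forall>t\<in>{0..1}. W t \<in> borel_measurable M) \<and>
     (\<forall>\<omega>\<in>space M. W 0 \<omega> = 0) \<and>
     (\<forall>\<omega>\<in>space M. continuous_on {0..1} (\<lambda>t. W t \<omega>)) \<and>
     (\<forall>s t. 0 \<le> s \<and> s < t \<and> t \<le> 1 \<longrightarrow>
        distributed M lborel (\<lambda>\<omega>. W t \<omega> - W s \<omega>) (normal_density 0 (sqrt (t - s)))) \<and>
     (\<forall>n (t :: nat \<Rightarrow> real). mono_on {0..n} t \<and> t ` {0..n} \<subseteq> {0..1} \<longrightarrow>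
        prob_space.indep_vars M (\<lambda>_. borel) (\<lambda>i \<omega>. W (t i) \<omega> - W (t (i - 1)) \<omega>) {1..n})"

(* The components are independent as processes, i.e. as random elements of the product
   space of real functions on {0..1}. *)
definition standard_brownian_motion_dim ::
    "nat \<Rightarrow> 'b measure \<Rightarrow> (nat \<Rightarrow> real \<Rightarrow> 'b \<Rightarrow> real) \<Rightarrow> bool" where
  "standard_brownian_motion_dim k M B \<longleftrightarrow>
     (\<forall>j\<in>{1..k}. standard_brownian_motion M (B j)) \<and>
     prob_space.indep_vars M (\<lambda>_. PiM {0..1} (\<lambda>_. borel))
       (\<lambda>j \<omega>. restrict (\<lambda>t. B j t \<omega>) {0..1}) {1..k}"

definition subdivisions :: "nat \<Rightarrow> (nat \<Rightarrow> real) set" where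
  "subdivisions k = {t. t 0 = 0 \<and> t k = 1 \<and> (\<forall>l\<in>{1..k}. t (l - 1) \<le> t l)}"

(* GREATEST because the set of values is infinite, which rules out Max. The maximum exists for
   continuous w and k > 0, see max_increments_attained. *)
definition max_increments :: "nat \<Rightarrow> (nat \<Rightarrow> real \<Rightarrow> real) \<Rightarrow> real" where
  "max_increments k w =
     (GREATEST s. \<exists>t\<in>subdivisions k. s = (\<Sum>l=1..k. w l (t l) - w l (t (l - 1))))"

lemma max_increments_attained:
  assumes k: "1 \<le> k" and w: "\<And>l. l \<in> {1..k} \<Longrightarrow> continuous_on {0..1} (w l)"
  shows "\<exists>t\<in>subdivisions k. max_increments k w = (\<Sum>l=1..k. w l (t l) - w l (t (l - 1)))"
    and "\<And>t. t \<in> subdivisions k \<Longrightarrow> (\<Sum>l=1..k. w l (t l) - w l (t (l - 1))) \<le> max_increments k w"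
proof -
  define f where "f t = (\<Sum>l=1..k. w l (t l) - w l (t (l - 1)))" for t :: "nat \<Rightarrow> real"
  define K :: "(nat \<Rightarrow> real) set" where "K = (\<Pi>\<^sub>E i\<in>UNIV. {0..1})"
  have "compact K"
    using compactin_PiE[of "\<lambda>_::nat. euclidean :: real topology" UNIV "\<lambda>_. {0..1}"]
    unfolding K_def by (simp add: euclidean_product_topology)
  moreover have "closed (subdivisions k)"
    unfolding subdivisions_def Ball_def
    by (intro closed_Collect_conj closed_Collect_eq closed_Collect_all closed_Collect_imp
        closed_Collect_le continuous_intros continuous_on_product_coordinates) auto
  ultimately have cK: "compact (K \<inter> subdivisions k)"
    by (rule compact_Int_closed)
  have cf: "continuous_on (K \<inter> subdivisions k) f"
    unfolding f_def
  proof (intro continuous_on_sum continuous_on_diff)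
    fix l assume l: "l \<in> {1..k}"
    have *: "continuous_on (K \<inter> subdivisions k) (\<lambda>t. w l (t i))" for i
      by (rule continuous_on_compose2[OF w[OF l]])
         (auto simp: K_def PiE_def Pi_def intro: continuous_on_subset[OF continuous_on_product_coordinates])
    show "continuous_on (K \<inter> subdivisions k) (\<lambda>t. w l (t l))" by (rule *)
    show "continuous_on (K \<inter> subdivisions k) (\<lambda>t. w l (t (l - 1)))" by (rule *)
  qed
  have cut: "(\<lambda>i. if i \<le> k then t i else 1) \<in> K \<inter> subdivisions k"
      "f (\<lambda>i. if i \<le> k then t i else 1) = f t" if t: "t \<in> subdivisions k" for t
  proof -
    have step: "t i \<le> t (Suc i)" if "i < k" for i
      using t that unfolding subdivisions_def by (auto dest: bspec[of _ _ "Suc i"])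
    have "0 \<le> t i" if "i \<le> k" for i
      using that
    proof (induction i)
      case 0 then show ?case using t by (simp add: subdivisions_def)
    next
      case (Suc i) then show ?case using step[of i] by simp
    qed
    moreover have "t i \<le> 1" if "i \<le> k" for i
      using that
    proof (induction i rule: inc_induct)
      case base then show ?case using t by (simp add: subdivisions_def)
    next
      case (step n) then show ?case using \<open>\<And>i. i < k \<Longrightarrow> t i \<le> t (Suc i)\<close>[of n] by simp
    qed
    ultimately show "(\<lambda>i. if i \<le> k then t i else 1) \<in> K \<inter> subdivisions k"
      using t by (auto simp: K_def subdivisions_def)
    show "f (\<lambda>i. if i \<le> k then t i else 1) = f t"
      unfolding f_def by (intro sum.cong) auto
  qed
  have "(\<lambda>i. if i = 0 then 0 else 1) \<in> subdivisions k"
    using k by (auto simp: subdivisions_def)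
  then have "K \<inter> subdivisions k \<noteq> {}"
    using cut(1) by blast
  from continuous_attains_sup[OF cK this cf] obtain u
    where u: "u \<in> subdivisions k" "\<And>t. t \<in> K \<inter> subdivisions k \<Longrightarrow> f t \<le> f u" by blast
  have max: "f t \<le> f u" if "t \<in> subdivisions k" for t
    using u(2)[OF cut(1)[OF that]] cut(2)[OF that] by simp
  have "max_increments k w = f u"
    unfolding max_increments_def f_def[symmetric]
    by (rule Greatest_equality) (use u(1) max in auto)
  then show "\<exists>t\<in>subdivisions k. max_increments k w = (\<Sum>l=1..k. w l (t l) - w l (t (l - 1)))"
    and "\<And>t. t \<in> subdivisions k \<Longrightarrow> (\<Sum>l=1..k. w l (t l) - w l (t (l - 1))) \<le> max_increments k w"
    using u(1) max unfolding f_def by auto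
qed

end

theory Submission
  imports Defs "HOL-Real_Asymp.Real_Asymp"
begin

text \<open>
  A weakly increasing subsequence of \<open>X 1, \<dots>, X n\<close> is read along an increasing path
  \<open>\<pi> : {1..n} \<rightarrow> {1..m}\<close>, which collects at time \<open>i\<close> a point if \<open>X i = \<alpha> (\<pi> i)\<close>.
  Hence the longest one has length \<open>path_max\<close>, the maximum over all such paths of the sum of the
  indicators met (\<open>longest_increasing_eq_path_max\<close>), and the limit variable is the same
  functional of Brownian increments on an infinitely fine grid
  (\<open>grid_path_max_tendsto_max_increments\<close>).

  Letters with \<open>p r < pmax\<close> are negligible. On any stretch of time, the excess of
  such a letter over a letter of probability \<open>pmax\<close> is a random walk with negative drift, so it
  exceeds \<open>D\<close> with probability at most \<open>exp (- \<kappa> D)\<close>. A union bound over all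
  stretches with \<open>D = n powr (1/4)\<close> shows that dropping these letters costs \<open>o (sqrt n)\<close>
  (\<open>rare_letters_negligible\<close>).

  What remains compares the path maximum of the centred and scaled indicator vectors of the \<open>k\<close>
  most likely letters with that of Gaussian vectors of the same covariance. This is done by Lindeberg's
  replacement method, applied to the maximum itself. The maximum of the path sums is smoothed to \<open>ln (\<Sum>\<pi>. exp (\<beta> * path_sum \<pi>)) / \<beta>\<close>.
  There are at most \<open>(n + 1) ^ k\<close> paths, so this changes it by \<open>O (ln n / \<beta>)\<close>. As a
  function of a single step it is a log-sum-exp of \<open>k\<close> linear functions whose third derivative is
  \<open>O (\<beta>\<^sup>2)\<close> times the cube of the step, whatever the other steps are
  (\<open>cos_log_sum_exp_taylor\<close>). Steps are of order \<open>1 / sqrt n\<close>. Exchanging all \<open>n\<close>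
  of them one after the other for steps with the same first two moments therefore costs
  \<open>O (\<beta>\<^sup>2 / sqrt n)\<close> (\<open>path_max_lindeberg\<close>). With \<open>\<beta> = n powr (1/8)\<close> both
  errors vanish.

  The indicator vector of the \<open>k\<close> letters has covariance \<open>pmax (I - pmax J)\<close>, where \<open>J\<close> is the
  all-ones matrix. Its square root is \<open>sqrt pmax (I + c J)\<close> with
  \<open>c = (sqrt (1 - k pmax) - 1) / k\<close>. The Gaussian steps are thus
  \<open>sqrt pmax (\<Delta>B\<^sup>l + c \<Sum>\<^sub>j \<Delta>B\<^sup>j)\<close>. The second summand does not depend on the
  path and adds up to \<open>c \<Sum>\<^sub>j B\<^sup>j(1)\<close>, which is the first term of the limit.

  The test functions \<open>x \<mapsto> cos (\<tau> x + \<theta>)\<close> give the real and the imaginary part of the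
  characteristic function for \<open>\<theta> = 0\<close> and \<open>\<theta> = - pi / 2\<close>, so Levy's continuity theorem
  turns the convergence of their expectations into weak convergence.
\<close>

section \<open>Increasing paths\<close>

text \<open>
  Paths are extensional functions, which makes the set finite and lets its elements be counted.
\<close>

definition increasing_paths :: "nat \<Rightarrow> nat \<Rightarrow> (nat \<Rightarrow> nat) set" where
  "increasing_paths n k = {\<pi> \<in> {1..n} \<rightarrow>\<^sub>E {1..k}. mono_on {1..n} \<pi>}"

definition path_sum :: "nat \<Rightarrow> (nat \<Rightarrow> nat \<Rightarrow> real) \<Rightarrow> (nat \<Rightarrow> nat) \<Rightarrow> real" where
  "path_sum n x \<pi> = (\<Sum>i=1..n. x i (\<pi> i))"

definition path_max :: "nat \<Rightarrow> nat \<Rightarrow> (nat \<Rightarrow> nat \<Rightarrow> real) \<Rightarrow> real" where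
  "path_max n k x = Max (path_sum n x ` increasing_paths n k)"

text \<open>
  For an increasing \<open>\<pi>\<close> the counted set is an initial segment of \<open>{1..n}\<close>, so this is
  also the last time at which \<open>\<pi>\<close> is at most \<open>l\<close>. The levels are the discrete counterpart of
  a subdivision.
\<close>

definition level :: "nat \<Rightarrow> (nat \<Rightarrow> nat) \<Rightarrow> nat \<Rightarrow> nat" where
  "level n \<pi> l = card {i \<in> {1..n}. \<pi> i \<le> l}"

lemma increasing_pathsI:
  assumes "\<And>i. i \<in> {1..n} \<Longrightarrow> f i \<in> {1..k}" and "mono_on {1..n} f"
  shows "restrict f {1..n} \<in> increasing_paths n k"
  using assms by (auto simp: increasing_paths_def mono_on_def)

lemma increasing_paths_range: "\<pi> \<in> increasing_paths n k \<Longrightarrow> i \<in> {1..n} \<Longrightarrow> \<pi> i \<in> {1..k}"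
  by (auto simp: increasing_paths_def)

lemma finite_increasing_paths [simp]: "finite (increasing_paths n k)"
  unfolding increasing_paths_def by (rule finite_subset[OF _ finite_PiE[of "{1..n}" "\<lambda>_. {1..k}"]]) auto

lemma increasing_paths_nonempty: "1 \<le> k \<Longrightarrow> increasing_paths n k \<noteq> {}"
  using increasing_pathsI[of n "\<lambda>_. 1" k] by (auto simp: mono_on_def)

lemma path_sum_restrict: "path_sum n x (restrict \<pi> {1..n}) = path_sum n x \<pi>"
  by (simp add: path_sum_def)

lemma path_sum_le_path_max: "\<pi> \<in> increasing_paths n k \<Longrightarrow> path_sum n x \<pi> \<le> path_max n k x"
  unfolding path_max_def by (rule Max_ge) auto

lemma path_max_attained:
  assumes "1 \<le> k" shows "\<exists>\<pi>\<in>increasing_paths n k. path_max n k x = path_sum n x \<pi>"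
proof -
  have "path_max n k x \<in> path_sum n x ` increasing_paths n k"
    unfolding path_max_def by (rule Max_in) (use increasing_paths_nonempty[OF assms] in auto)
  then show ?thesis by auto
qed

lemma path_le_iff_level:
  assumes \<pi>: "mono_on {1..n} \<pi>" and i: "i \<in> {1..n}"
  shows "\<pi> i \<le> l \<longleftrightarrow> i \<le> level n \<pi> l"
proof -
  define S where "S = {i \<in> {1..n}. \<pi> i \<le> l}"
  have down: "{1..i} \<subseteq> S" if "i \<in> S" for i
    using that mono_onD[OF \<pi>, of _ i] by (fastforce simp: S_def)
  have "S = {1..card S}"
  proof (cases "S = {}")
    case False
    then have M: "Max S \<in> S" by (intro Max_in) (auto simp: S_def)
    then have "S = {1..Max S}"
      using down[OF M] by (auto simp: S_def)
    then show ?thesis by (metis card_atLeastAtMost diff_Suc_1)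
  qed simp
  then have "i \<in> S \<longleftrightarrow> i \<in> {1..card S}" by (rule arg_cong)
  moreover have "card S = level n \<pi> l" by (simp add: S_def level_def)
  moreover have "i \<in> S \<longleftrightarrow> \<pi> i \<le> l" using i by (simp add: S_def)
  ultimately show ?thesis using i by simp
qed

lemma level_le: "level n \<pi> l \<le> n"
proof -
  have "card {i \<in> {1..n}. \<pi> i \<le> l} \<le> card {1..n}" by (rule card_mono) auto
  then show ?thesis by (simp add: level_def)
qed

lemma level_mono: "l \<le> l' \<Longrightarrow> level n \<pi> l \<le> level n \<pi> l'"
  unfolding level_def by (rule card_mono) auto

lemma level_0: "\<pi> \<in> increasing_paths n k \<Longrightarrow> level n \<pi> 0 = 0"
  using increasing_paths_range[of \<pi> n k] by (force simp: level_def)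

lemma level_last: "\<pi> \<in> increasing_paths n k \<Longrightarrow> level n \<pi> k = n"
proof -
  assume "\<pi> \<in> increasing_paths n k"
  then have "{i \<in> {1..n}. \<pi> i \<le> k} = {1..n}" using increasing_paths_range by auto
  then show ?thesis by (simp add: level_def)
qed

lemma path_fibre:
  assumes "mono_on {1..n} \<pi>" "1 \<le> l"
  shows "{i \<in> {1..n}. \<pi> i = l} = {level n \<pi> (l - 1)<..level n \<pi> l}"
proof -
  have eq: "\<pi> i = l \<longleftrightarrow> level n \<pi> (l - 1) < i \<and> i \<le> level n \<pi> l" if "i \<in> {1..n}" for i
    using assms(2) path_le_iff_level[OF assms(1) that, of l] path_le_iff_level[OF assms(1) that, of "l - 1"]
    by linarith
  have "i \<in> {1..n} \<and> \<pi> i = l \<longleftrightarrow> i \<in> {level n \<pi> (l - 1)<..level n \<pi> l}" for i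
    using eq[of i] level_le[of n \<pi> l] by (cases "i \<in> {1..n}") auto
  then show ?thesis by blast
qed

lemma path_sum_by_level:
  assumes \<pi>: "\<pi> \<in> increasing_paths n k"
  shows "path_sum n x \<pi> = (\<Sum>l=1..k. \<Sum>i\<in>{level n \<pi> (l - 1)<..level n \<pi> l}. x i l)"
proof -
  have "path_sum n x \<pi> = (\<Sum>l=1..k. \<Sum>i\<in>{i \<in> {1..n}. \<pi> i = l}. x i (\<pi> i))"
    unfolding path_sum_def by (rule sum.group[symmetric]) (use increasing_paths_range[OF \<pi>] in auto)
  also have "\<dots> = (\<Sum>l=1..k. \<Sum>i\<in>{level n \<pi> (l - 1)<..level n \<pi> l}. x i l)"
  proof (rule sum.cong[OF refl])
    fix l assume "l \<in> {1..k}"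
    then have "{i \<in> {1..n}. \<pi> i = l} = {level n \<pi> (l - 1)<..level n \<pi> l}"
      using path_fibre[of n \<pi> l] \<pi> by (simp add: increasing_paths_def)
    moreover have "(\<Sum>i\<in>{i \<in> {1..n}. \<pi> i = l}. x i (\<pi> i)) = (\<Sum>i\<in>{i \<in> {1..n}. \<pi> i = l}. x i l)"
      by (rule sum.cong) auto
    ultimately show "(\<Sum>i\<in>{i \<in> {1..n}. \<pi> i = l}. x i (\<pi> i)) = (\<Sum>i\<in>{level n \<pi> (l - 1)<..level n \<pi> l}. x i l)"
      by simp
  qed
  finally show ?thesis .
qed

text \<open>
  A path is determined by its \<open>k\<close> levels. That the number of paths is polynomial in \<open>n\<close> is
  what makes the smoothing of the maximum cheap.
\<close>

lemma card_increasing_paths: "card (increasing_paths n k) \<le> (n + 1) ^ k"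
proof -
  have "inj_on (\<lambda>\<pi>. restrict (level n \<pi>) {1..k}) (increasing_paths n k)"
  proof (rule inj_onI)
    fix \<pi> \<rho> assume \<pi>: "\<pi> \<in> increasing_paths n k" and \<rho>: "\<rho> \<in> increasing_paths n k"
      and eq: "restrict (level n \<pi>) {1..k} = restrict (level n \<rho>) {1..k}"
    have mono: "mono_on {1..n} \<pi>" "mono_on {1..n} \<rho>"
      using \<pi> \<rho> by (simp_all add: increasing_paths_def)
    have lev: "level n \<pi> l = level n \<rho> l" if "l \<in> {1..k}" for l
      using fun_cong[OF eq, of l] that by simp
    have "\<pi> i = \<rho> i" if i: "i \<in> {1..n}" for i
    proof -
      have "\<pi> i \<le> l \<longleftrightarrow> \<rho> i \<le> l" if "l \<in> {1..k}" for l
        unfolding path_le_iff_level[OF mono(1) i] path_le_iff_level[OF mono(2) i] lev[OF that] ..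
      from this[OF increasing_paths_range[OF \<pi> i]] this[OF increasing_paths_range[OF \<rho> i]]
      show ?thesis by simp
    qed
    moreover have "\<pi> \<in> {1..n} \<rightarrow>\<^sub>E {1..k}" "\<rho> \<in> {1..n} \<rightarrow>\<^sub>E {1..k}"
      using \<pi> \<rho> by (simp_all add: increasing_paths_def)
    ultimately show "\<pi> = \<rho>" by (metis PiE_ext)
  qed
  moreover have "(\<lambda>\<pi>. restrict (level n \<pi>) {1..k}) ` increasing_paths n k \<subseteq> {1..k} \<rightarrow>\<^sub>E {0..n}"
    by (intro image_subsetI restrict_PiE_iff[THEN iffD2] ballI) (simp add: level_le)
  ultimately have "card (increasing_paths n k) \<le> card ({1..k} \<rightarrow>\<^sub>E {0..n})"
    by (rule card_inj_on_le) (intro finite_PiE, simp_all)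
  then show ?thesis by (simp add: card_PiE)
qed

text \<open>
  Given a longest increasing subsequence, the path that stays at the largest letter used so far collects
  every point of it. Conversely the points that a path collects form an increasing subsequence.
\<close>

lemma longest_increasing_eq_path_max:
  fixes x :: "nat \<Rightarrow> 'c::linorder"
  assumes \<alpha>: "strict_mono_on {1..m} \<alpha>" and x: "x ` {1..n} \<subseteq> \<alpha> ` {1..m}" and m: "1 \<le> m"
  shows "real (longest_increasing x n) = path_max n m (\<lambda>i r. of_bool (x i = \<alpha> r))"
proof -
  define A :: "nat set" where "A = {l. \<exists>i. strict_mono_on {1..l} i \<and> i ` {1..l} \<subseteq> {1..n} \<and> mono_on {1..l} (\<lambda>a. x (i a))}"
  let ?y = "\<lambda>i r. of_bool (x i = \<alpha> r) :: real"
  have "l \<le> n" if "l \<in> A" for l :: nat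
  proof -
    from that obtain i where i: "strict_mono_on {1..l} i" "i ` {1..l} \<subseteq> {1..n}" by (auto simp: A_def)
    have "card {1..l} \<le> card {1..n}"
      by (rule card_inj_on_le[of i]) (use i strict_mono_on_imp_inj_on in auto)
    then show ?thesis by simp
  qed
  then have finA: "finite A" by (auto intro: finite_subset[of A "{0..n}"])
  have LI: "longest_increasing x n = Max A" by (simp add: longest_increasing_def A_def)
  have "0 \<in> A" by (auto simp: A_def strict_mono_on_def mono_on_def)
  with finA have "Max A \<in> A" by (intro Max_in) auto
  then obtain i where i: "strict_mono_on {1..Max A} i" "i ` {1..Max A} \<subseteq> {1..n}"
    "mono_on {1..Max A} (\<lambda>a. x (i a))" by (auto simp: A_def)
  define S where "S = i ` {1..Max A}"
  have S: "S \<subseteq> {1..n}" "finite S" "card S = Max A"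
    using i card_image[OF strict_mono_on_imp_inj_on[OF i(1)]] by (auto simp: S_def)
  have monoS: "x s \<le> x t" if st: "s \<in> S" "t \<in> S" "s \<le> t" for s t
  proof -
    obtain a b where ab: "a \<in> {1..Max A}" "b \<in> {1..Max A}" "s = i a" "t = i b" using st by (auto simp: S_def)
    have "a \<le> b"
    proof (rule ccontr)
      assume "\<not> a \<le> b"
      then have "i b < i a" using i(1) ab by (auto simp: strict_mono_on_def)
      then show False using ab st by simp
    qed
    then show ?thesis using i(3) ab by (auto simp: mono_on_def)
  qed
  define rk where "rk s = inv_into {1..m} \<alpha> (x s)" for s
  have rk: "rk s \<in> {1..m}" "\<alpha> (rk s) = x s" if "s \<in> {1..n}" for s
    using that x inv_into_into[of "x s" \<alpha> "{1..m}"] f_inv_into_f[of "x s" \<alpha> "{1..m}"]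
    unfolding rk_def by (auto simp: image_subset_iff)
  have rk_mono: "rk s \<le> rk t" if st: "s \<in> S" "t \<in> S" "s \<le> t" for s t
  proof (rule ccontr)
    assume "\<not> rk s \<le> rk t"
    moreover have "s \<in> {1..n}" "t \<in> {1..n}" using st S by auto
    ultimately have "\<alpha> (rk t) < \<alpha> (rk s)" using strict_mono_onD[OF \<alpha> rk(1) rk(1)] by (simp add: not_le)
    then show False using monoS[OF st] rk(2) \<open>s \<in> {1..n}\<close> \<open>t \<in> {1..n}\<close> by simp
  qed
  \<comment> \<open>The value 1 serves the times before the first element of the subsequence.\<close>
  define \<pi> where "\<pi> t = Max (insert 1 (rk ` {s \<in> S. s \<le> t}))" for t
  have "restrict \<pi> {1..n} \<in> increasing_paths n m"
  proof (rule increasing_pathsI)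
    fix t
    have "\<pi> t \<in> insert 1 (rk ` {s \<in> S. s \<le> t})" unfolding \<pi>_def by (rule Max_in) (use S in auto)
    then show "\<pi> t \<in> {1..m}" using rk(1) S m by auto
  next
    show "mono_on {1..n} \<pi>" unfolding \<pi>_def
      by (intro mono_onI Max_mono) (use S in auto)
  qed
  from path_sum_le_path_max[OF this, of ?y] have "path_sum n ?y \<pi> \<le> path_max n m ?y"
    unfolding path_sum_restrict .
  moreover have "real (Max A) \<le> path_sum n ?y \<pi>"
  proof -
    have "\<pi> s = rk s" if "s \<in> S" for s
      unfolding \<pi>_def by (rule Max_eqI) (use S rk(1)[of s] rk_mono that in \<open>auto simp: Suc_le_eq\<close>)
    then have "x s = \<alpha> (\<pi> s)" if "s \<in> S" for s using rk(2)[of s] that S by auto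
    then have "(\<Sum>s\<in>S. ?y s (\<pi> s)) = real (card S)" by simp
    moreover have "(\<Sum>s\<in>S. ?y s (\<pi> s)) \<le> path_sum n ?y \<pi>"
      unfolding path_sum_def by (rule sum_mono2) (use S in auto)
    ultimately show ?thesis using S by simp
  qed
  moreover have "path_max n m ?y \<le> real (Max A)"
  proof -
    obtain \<rho> where \<rho>: "\<rho> \<in> increasing_paths n m" "path_max n m ?y = path_sum n ?y \<rho>"
      using path_max_attained[OF m] by blast
    define T where "T = {t \<in> {1..n}. x t = \<alpha> (\<rho> t)}"
    have T: "finite T" "T \<subseteq> {1..n}" by (auto simp: T_def)
    have "path_sum n ?y \<rho> = (\<Sum>t\<in>{1..n}. if t \<in> T then 1 else 0)"
      unfolding path_sum_def by (rule sum.cong) (auto simp: T_def)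
    also have "\<dots> = real (card T)" using T by (simp add: sum.If_cases Int_absorb1)
    finally have card: "path_sum n ?y \<rho> = real (card T)" .
    obtain h where h: "bij_betw h {..<card T} T" "strict_mono_on {..<card T} h"
      using ex_bij_betw_strict_mono_card[OF T(1)] by blast
    have hT: "h a \<in> T" if "a < card T" for a using h(1) that by (auto simp: bij_betw_def)
    have "x (h a) \<le> x (h b)" if "a \<le> b" "b < card T" for a b
    proof -
      have "h a \<le> h b" using h(2) that by (cases "a = b") (auto simp: strict_mono_on_def intro: less_imp_le)
      moreover have h_in: "h a \<in> {1..n}" "h b \<in> {1..n}"
        using subsetD[OF T(2) hT] that by (simp_all del: atLeastAtMost_iff)
      moreover have "mono_on {1..n} \<rho>" using \<rho>(1) by (simp add: increasing_paths_def)
      ultimately have "\<rho> (h a) \<le> \<rho> (h b)" using mono_onD by blast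
      then have "\<alpha> (\<rho> (h a)) \<le> \<alpha> (\<rho> (h b))"
        using strict_mono_on_leD[OF \<alpha>] increasing_paths_range[OF \<rho>(1)] h_in by blast
      then show ?thesis using hT[of a] hT[of b] that by (auto simp: T_def)
    qed
    then have "mono_on {1..card T} (\<lambda>a. x (h (a - 1)))"
      by (intro mono_onI) simp
    moreover have "strict_mono_on {1..card T} (\<lambda>a. h (a - 1))"
      by (intro strict_mono_onI strict_mono_onD[OF h(2)]) auto
    moreover have "(\<lambda>a. h (a - 1)) ` {1..card T} \<subseteq> {1..n}"
      by (intro image_subsetI subsetD[OF T(2) hT]) auto
    ultimately have "card T \<in> A" unfolding A_def by blast
    then show ?thesis using finA card \<rho> by simp
  qed
  ultimately show ?thesis using LI by simp
qed

lemma path_max_sublist_le: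
  assumes "strict_mono_on {1..k} j" "j ` {1..k} \<subseteq> {1..m}" "1 \<le> k"
  shows "path_max n k (\<lambda>i l. y i (j l)) \<le> path_max n m y"
proof -
  obtain \<pi> where \<pi>: "\<pi> \<in> increasing_paths n k" "path_max n k (\<lambda>i l. y i (j l)) = path_sum n (\<lambda>i l. y i (j l)) \<pi>"
    using path_max_attained[OF assms(3)] by blast
  have "restrict (j \<circ> \<pi>) {1..n} \<in> increasing_paths n m"
  proof (rule increasing_pathsI)
    show "(j \<circ> \<pi>) i \<in> {1..m}" if "i \<in> {1..n}" for i
      using increasing_paths_range[OF \<pi>(1) that] assms(2) by (auto simp del: atLeastAtMost_iff)
    have "mono_on {1..k} j" using assms(1) by (rule strict_mono_on_imp_mono_on)
    then show "mono_on {1..n} (j \<circ> \<pi>)"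
      using \<pi>(1) by (auto simp: increasing_paths_def mono_on_def Pi_iff PiE_def)
  qed
  from path_sum_le_path_max[OF this, of y] show ?thesis
    unfolding \<pi>(2) by (simp add: path_sum_def)
qed

text \<open>
  Composing a path through all letters with an increasing map onto the selected ones gives a path
  through the selected letters. Every letter \<open>r\<close> occupies one interval of time, so the two sums
  differ by at most one interval sum for each unselected letter.
\<close>

lemma path_max_le_sublist:
  assumes j: "strict_mono_on {1..k} j" "j ` {1..k} \<subseteq> {1..m}" "1 \<le> k" and D: "0 \<le> D"
    and le: "\<And>r l a b. r \<in> {1..m} - j ` {1..k} \<Longrightarrow> l \<in> {1..k} \<Longrightarrow> a \<le> b \<Longrightarrow> b \<le> n \<Longrightarrow>
               (\<Sum>i\<in>{a<..b}. y i r - y i (j l)) \<le> D"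
  shows "path_max n m y \<le> path_max n k (\<lambda>i l. y i (j l)) + real m * D"
proof -
  have "j 1 \<in> {1..m}" using subsetD[OF j(2) imageI[of 1]] j(3) by simp
  then have "1 \<le> m" by simp
  then obtain \<pi> where \<pi>: "\<pi> \<in> increasing_paths n m" "path_max n m y = path_sum n y \<pi>"
    using path_max_attained by blast
  \<comment> \<open>The last selected letter up to \<open>r\<close>, or the first one if there is none; it fixes the selected letters.\<close>
  define \<sigma> where "\<sigma> r = max 1 (card {l \<in> {1..k}. j l \<le> r})" for r
  have \<sigma>_range: "\<sigma> r \<in> {1..k}" for r
  proof -
    have "card {l \<in> {1..k}. j l \<le> r} \<le> card {1..k}" by (rule card_mono) auto
    then show ?thesis using j(3) by (simp add: \<sigma>_def)
  qed
  have \<sigma>_mono: "\<sigma> r \<le> \<sigma> s" if "r \<le> s" for r s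
    unfolding \<sigma>_def using that by (intro max.mono card_mono) auto
  have \<sigma>_j: "\<sigma> (j l) = l" if "l \<in> {1..k}" for l
  proof -
    have "j l' \<le> j l \<longleftrightarrow> l' \<le> l" if l': "l' \<in> {1..k}" for l'
      using strict_mono_onD[OF j(1) l' \<open>l \<in> {1..k}\<close>] strict_mono_onD[OF j(1) \<open>l \<in> {1..k}\<close> l']
      by (cases l l' rule: linorder_cases) simp_all
    then have "l' \<in> {l' \<in> {1..k}. j l' \<le> j l} \<longleftrightarrow> l' \<in> {1..l}" for l'
      using that by (cases "l' \<in> {1..k}") auto
    then have "{l' \<in> {1..k}. j l' \<le> j l} = {1..l}" by blast
    then show ?thesis using that by (simp add: \<sigma>_def)
  qed
  have "restrict (\<sigma> \<circ> \<pi>) {1..n} \<in> increasing_paths n k"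
    using \<pi>(1) \<sigma>_range \<sigma>_mono by (intro increasing_pathsI) (auto simp: increasing_paths_def mono_on_def)
  from path_sum_le_path_max[OF this, of "\<lambda>i l. y i (j l)"]
  have 1: "path_sum n (\<lambda>i r. y i (j (\<sigma> r))) \<pi> \<le> path_max n k (\<lambda>i l. y i (j l))"
    by (simp add: path_sum_def)
  have "path_sum n y \<pi> - path_sum n (\<lambda>i r. y i (j (\<sigma> r))) \<pi> = path_sum n (\<lambda>i r. y i r - y i (j (\<sigma> r))) \<pi>"
    by (simp add: path_sum_def sum_subtractf)
  also have "\<dots> = (\<Sum>r=1..m. \<Sum>i\<in>{level n \<pi> (r - 1)<..level n \<pi> r}. y i r - y i (j (\<sigma> r)))"
    by (rule path_sum_by_level[OF \<pi>(1)])
  also have "\<dots> \<le> (\<Sum>r=1..m. D)"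
  proof (rule sum_mono)
    fix r assume r: "r \<in> {1..m}"
    show "(\<Sum>i\<in>{level n \<pi> (r - 1)<..level n \<pi> r}. y i r - y i (j (\<sigma> r))) \<le> D"
    proof (cases "r \<in> j ` {1..k}")
      case True
      then show ?thesis using \<sigma>_j D by auto
    next
      case False
      then show ?thesis using le \<sigma>_range r level_mono level_le by auto
    qed
  qed
  finally show ?thesis using 1 \<pi>(2) by simp
qed

section \<open>Smoothing the path maximum\<close>

definition soft_max :: "real \<Rightarrow> nat \<Rightarrow> nat \<Rightarrow> (nat \<Rightarrow> nat \<Rightarrow> real) \<Rightarrow> real" where
  "soft_max \<beta> n k x = ln (\<Sum>\<pi>\<in>increasing_paths n k. exp (\<beta> * path_sum n x \<pi>)) / \<beta>"

lemma path_max_le_soft_max: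
  assumes "0 < \<beta>" "1 \<le> k"
  shows "path_max n k x \<le> soft_max \<beta> n k x"
proof -
  obtain \<pi> where \<pi>: "\<pi> \<in> increasing_paths n k" "path_max n k x = path_sum n x \<pi>"
    using path_max_attained[OF assms(2)] by blast
  have "exp (\<beta> * path_sum n x \<pi>) \<le> (\<Sum>\<pi>\<in>increasing_paths n k. exp (\<beta> * path_sum n x \<pi>))"
    by (rule member_le_sum[OF \<pi>(1)]) auto
  then have "\<beta> * path_sum n x \<pi> \<le> ln (\<Sum>\<pi>\<in>increasing_paths n k. exp (\<beta> * path_sum n x \<pi>))"
    by (metis exp_gt_zero ln_exp ln_mono order_less_le_trans)
  then show ?thesis
    using assms(1) \<pi>(2) by (simp add: soft_max_def field_simps)
qed

text \<open>
  The sum of exponentials is at most the number of paths times its largest term.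
\<close>

lemma soft_max_le_path_max:
  assumes "0 < \<beta>" "1 \<le> k"
  shows "soft_max \<beta> n k x \<le> path_max n k x + real k * ln (real n + 1) / \<beta>"
proof -
  let ?S = "\<Sum>\<pi>\<in>increasing_paths n k. exp (\<beta> * path_sum n x \<pi>)"
  have "?S \<le> (\<Sum>\<pi>\<in>increasing_paths n k. exp (\<beta> * path_max n k x))"
    using assms by (intro sum_mono) (simp add: path_sum_le_path_max)
  also have "\<dots> \<le> (real n + 1) ^ k * exp (\<beta> * path_max n k x)"
    using card_increasing_paths[of n k] by (simp add: of_nat_le_iff[symmetric, where 'a=real] add.commute)
  finally have "?S \<le> (real n + 1) ^ k * exp (\<beta> * path_max n k x)" .
  moreover have "0 < ?S"
    using increasing_paths_nonempty[OF assms(2)] by (intro sum_pos) auto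
  ultimately have "ln ?S \<le> ln ((real n + 1) ^ k * exp (\<beta> * path_max n k x))"
    by (intro ln_mono) auto
  also have "\<dots> = real k * ln (real n + 1) + \<beta> * path_max n k x"
    by (simp add: ln_mult ln_realpow)
  finally show ?thesis using assms by (simp add: soft_max_def field_simps)
qed

text \<open>
  The paths are grouped by their value at time \<open>i\<close>. The coefficients \<open>A l\<close> collect all the
  other steps, so that they do not depend on the step that is exchanged.
\<close>

lemma soft_max_step:
  assumes k: "1 \<le> k" and i: "i \<in> {1..n}"
  obtains A :: "nat \<Rightarrow> real" where "\<And>l. 0 \<le> A l" "\<exists>l\<in>{1..k}. 0 < A l"
    "\<And>y. soft_max \<beta> n k (x(i := y)) = ln (\<Sum>l=1..k. A l * exp (\<beta> * y l)) / \<beta>"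
proof -
  define A where "A l = (\<Sum>\<pi>\<in>{\<pi> \<in> increasing_paths n k. \<pi> i = l}.
    exp (\<beta> * (\<Sum>i'\<in>{1..n} - {i}. x i' (\<pi> i'))))" for l
  have nn: "0 \<le> A l" for l unfolding A_def by (intro sum_nonneg) auto
  obtain \<pi> where \<pi>: "\<pi> \<in> increasing_paths n k" using increasing_paths_nonempty[OF k] by blast
  have "0 < A (\<pi> i)" unfolding A_def using \<pi> by (intro sum_pos) auto
  then have pos: "\<exists>l\<in>{1..k}. 0 < A l" using increasing_paths_range[OF \<pi> i] by blast
  have "(\<Sum>\<pi>\<in>increasing_paths n k. exp (\<beta> * path_sum n (x(i := y)) \<pi>)) = (\<Sum>l=1..k. A l * exp (\<beta> * y l))" for y
  proof -
    have split: "path_sum n (x(i := y)) \<pi> = (\<Sum>i'\<in>{1..n} - {i}. x i' (\<pi> i')) + y (\<pi> i)" for \<pi>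
      unfolding path_sum_def by (subst sum.remove[OF _ i]) auto
    have "(\<Sum>\<pi>\<in>increasing_paths n k. exp (\<beta> * path_sum n (x(i := y)) \<pi>))
      = (\<Sum>l=1..k. \<Sum>\<pi>\<in>{\<pi> \<in> increasing_paths n k. \<pi> i = l}. exp (\<beta> * path_sum n (x(i := y)) \<pi>))"
      by (rule sum.group[symmetric]) (use increasing_paths_range[OF _ i] in auto)
    also have "\<dots> = (\<Sum>l=1..k. A l * exp (\<beta> * y l))"
      unfolding A_def sum_distrib_right
      by (rule sum.cong[OF refl], rule sum.cong[OF refl]) (auto simp: split exp_add distrib_left)
    finally show ?thesis .
  qed
  then show ?thesis using that[OF nn pos] by (simp add: soft_max_def)
qed

text \<open>
  Along the ray \<open>s \<mapsto> s y\<close>, the weights \<open>A l exp (\<beta> s y l)\<close> normalise to a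
  probability on \<open>L\<close>, and with \<open>m q\<close> the \<open>q\<close>-th moment of \<open>y\<close> under it one has
  \<open>m q' = \<beta> (m (q + 1) - m q * m 1)\<close> and \<open>(ln (\<Sum>\<dots>) / \<beta>)' = m 1\<close>. All derivatives
  are thus polynomials in moments, and the third one is bounded uniformly in the weights.
\<close>

lemma cos_log_sum_exp_taylor:
  fixes A y :: "nat \<Rightarrow> real" and \<tau> \<theta> \<beta> :: real and L :: "nat set"
  assumes L: "finite L" and A: "\<And>l. 0 \<le> A l" "\<exists>l\<in>L. 0 < A l" and \<beta>: "0 < \<beta>"
  defines "v \<equiv> \<tau> * (ln (\<Sum>l\<in>L. A l) / \<beta>) + \<theta>"
    and "m \<equiv> \<lambda>q. (\<Sum>l\<in>L. A l * y l ^ q) / (\<Sum>l\<in>L. A l)"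
  shows "\<bar>cos (\<tau> * (ln (\<Sum>l\<in>L. A l * exp (\<beta> * y l)) / \<beta>) + \<theta>)
      - (cos v - \<tau> * sin v * m 1 - (\<tau>\<^sup>2 * cos v * (m 1)\<^sup>2 + \<tau> * \<beta> * sin v * (m 2 - (m 1)\<^sup>2)) / 2)\<bar>
    \<le> (\<bar>\<tau>\<bar> ^ 3 + 6 * \<tau>\<^sup>2 * \<beta> + 6 * \<bar>\<tau>\<bar> * \<beta>\<^sup>2) / 6 * (\<Sum>l\<in>L. \<bar>y l\<bar> ^ 3)"
proof -
  define P where "P q s = (\<Sum>l\<in>L. A l * y l ^ q * exp (\<beta> * (s * y l)))" for q and s :: real
  define M where "M q s = P q s / P 0 s" for q s
  have P0: "0 < P 0 s" for s
  proof -
    obtain l where l: "l \<in> L" "0 < A l" using A(2) by blast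
    have "A l * exp (\<beta> * (s * y l)) \<le> P 0 s"
      unfolding P_def by (simp, rule member_le_sum[OF l(1)]) (use A L in auto)
    moreover have "0 < A l * exp (\<beta> * (s * y l))" using l by simp
    ultimately show ?thesis by linarith
  qed
  have dP: "(P q has_real_derivative \<beta> * P (Suc q) s) (at s)" for q s
    unfolding P_def by (auto intro!: derivative_eq_intros simp: sum_distrib_left sum_distrib_right ac_simps)
  have dM: "(M q has_real_derivative \<beta> * (M (Suc q) s - M q s * M 1 s)) (at s)" for q s
  proof -
    have "(M q has_real_derivative (\<beta> * P (Suc q) s * P 0 s - P q s * (\<beta> * P 1 s)) / (P 0 s * P 0 s)) (at s)"
      unfolding M_def using dP[of q s] dP[of 0 s] P0[of s] by (auto intro!: derivative_eq_intros)
    moreover have "(\<beta> * P (Suc q) s * P 0 s - P q s * (\<beta> * P 1 s)) / (P 0 s * P 0 s) = \<beta> * (M (Suc q) s - M q s * M 1 s)"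
      using P0[of s] by (simp add: M_def field_simps)
    ultimately show ?thesis by simp
  qed
  define \<phi> where "\<phi> s = \<tau> * (ln (P 0 s) / \<beta>) + \<theta>" for s
  have d\<phi>: "(\<phi> has_real_derivative \<tau> * M 1 s) (at s)" for s
    unfolding \<phi>_def using dP[of 0 s] P0[of s] \<beta>
    by (auto intro!: derivative_eq_intros simp: M_def field_simps)
  define D where "D q s = (
      if q = 0 then cos (\<phi> s)
      else if q = 1 then - \<tau> * sin (\<phi> s) * M 1 s
      else if q = 2 then - (\<tau>\<^sup>2 * cos (\<phi> s) * (M 1 s)\<^sup>2 + \<tau> * \<beta> * sin (\<phi> s) * (M 2 s - (M 1 s)\<^sup>2))
      else \<tau> ^ 3 * sin (\<phi> s) * M 1 s ^ 3 - 3 * \<tau>\<^sup>2 * \<beta> * cos (\<phi> s) * (M 1 s * (M 2 s - (M 1 s)\<^sup>2))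
        - \<tau> * \<beta>\<^sup>2 * sin (\<phi> s) * (M 3 s - 3 * M 1 s * M 2 s + 2 * M 1 s ^ 3))" for q :: nat and s
  have dD: "(D q has_real_derivative D (Suc q) s) (at s)" if "q < 3" for q s
  proof -
    have S: "Suc (Suc 0) = 2" "Suc 2 = 3" by auto
    consider "q = 0" | "q = 1" | "q = 2" using \<open>q < 3\<close> by linarith
    then show ?thesis
    proof cases
      case 1
      have "((\<lambda>s. cos (\<phi> s)) has_real_derivative (- \<tau> * sin (\<phi> s) * M 1 s)) (at s)"
        by (rule derivative_eq_intros d\<phi> refl)+ simp
      then show ?thesis unfolding 1 D_def by simp
    next
      case 2
      have "((\<lambda>s. - \<tau> * sin (\<phi> s) * M 1 s) has_real_derivative
          - (\<tau>\<^sup>2 * cos (\<phi> s) * (M 1 s)\<^sup>2 + \<tau> * \<beta> * sin (\<phi> s) * (M 2 s - (M 1 s)\<^sup>2))) (at s)"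
        by (rule derivative_eq_intros d\<phi> dM refl)+ (simp add: S algebra_simps power2_eq_square)
      then show ?thesis unfolding 2 D_def by simp
    next
      case 3
      have "((\<lambda>s. - (\<tau>\<^sup>2 * cos (\<phi> s) * (M 1 s)\<^sup>2 + \<tau> * \<beta> * sin (\<phi> s) * (M 2 s - (M 1 s)\<^sup>2))) has_real_derivative
          \<tau> ^ 3 * sin (\<phi> s) * M 1 s ^ 3 - 3 * \<tau>\<^sup>2 * \<beta> * cos (\<phi> s) * (M 1 s * (M 2 s - (M 1 s)\<^sup>2))
        - \<tau> * \<beta>\<^sup>2 * sin (\<phi> s) * (M 3 s - 3 * M 1 s * M 2 s + 2 * M 1 s ^ 3)) (at s)"
        by (rule derivative_eq_intros d\<phi> dM refl)+
          (simp add: S algebra_simps power2_eq_square power3_eq_cube)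
      then show ?thesis unfolding 3 D_def by simp
    qed
  qed
  \<comment> \<open>Taylor expansion at \<open>s = 0\<close>, evaluated at \<open>s = 1\<close>, with Lagrange remainder \<open>D 3 t / 6\<close>.\<close>
  have "D 0 = (\<lambda>s. cos (\<phi> s))" by (simp add: D_def fun_eq_iff)
  from Maclaurin[of 1 3 D, OF _ _ this] dD
  have "\<exists>t. 0 < t \<and> t < 1 \<and> cos (\<phi> 1) = (\<Sum>q<3. D q 0 / fact q * 1 ^ q) + D 3 t / fact 3 * 1 ^ 3"
    by simp
  then obtain t where t: "cos (\<phi> 1) = D 0 0 + D 1 0 + D 2 0 / 2 + D 3 t / 6"
    by (auto simp: eval_nat_numeral)
  define R where "R = Max (insert 0 ((\<lambda>l. \<bar>y l\<bar>) ` L))"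
  have R: "0 \<le> R" "\<And>l. l \<in> L \<Longrightarrow> \<bar>y l\<bar> \<le> R" using L by (auto simp: R_def)
  have R3: "R ^ 3 \<le> (\<Sum>l\<in>L. \<bar>y l\<bar> ^ 3)"
  proof -
    have "R \<in> insert 0 ((\<lambda>l. \<bar>y l\<bar>) ` L)" unfolding R_def by (rule Max_in) (use L in auto)
    then consider "R = 0" | l where "l \<in> L" "R = \<bar>y l\<bar>" by auto
    then show ?thesis
    proof cases
      case 1 then show ?thesis by (simp add: sum_nonneg)
    next
      case 2 then show ?thesis using member_le_sum[of l L "\<lambda>l. \<bar>y l\<bar> ^ 3"] L by auto
    qed
  qed
  have MR: "\<bar>M q s\<bar> \<le> R ^ q" for q s
  proof -
    have "\<bar>P q s\<bar> \<le> (\<Sum>l\<in>L. \<bar>A l * y l ^ q * exp (\<beta> * (s * y l))\<bar>)"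
      unfolding P_def by (rule sum_abs)
    also have "\<dots> \<le> (\<Sum>l\<in>L. R ^ q * (A l * y l ^ 0 * exp (\<beta> * (s * y l))))"
    proof (rule sum_mono)
      fix l assume "l \<in> L"
      then have "\<bar>y l ^ q\<bar> \<le> R ^ q" unfolding power_abs by (intro power_mono R) auto
      then have "\<bar>y l ^ q\<bar> * (A l * exp (\<beta> * (s * y l))) \<le> R ^ q * (A l * exp (\<beta> * (s * y l)))"
        by (rule mult_right_mono) (use A in auto)
      then show "\<bar>A l * y l ^ q * exp (\<beta> * (s * y l))\<bar> \<le> R ^ q * (A l * y l ^ 0 * exp (\<beta> * (s * y l)))"
        using A(1)[of l] by (simp add: abs_mult ac_simps)
    qed
    also have "\<dots> = R ^ q * P 0 s" by (simp add: P_def sum_distrib_left)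
    finally show ?thesis using P0[of s] by (simp add: M_def field_simps)
  qed
  have "\<bar>D 3 t\<bar> \<le> (\<bar>\<tau>\<bar> ^ 3 + 6 * \<tau>\<^sup>2 * \<beta> + 6 * \<bar>\<tau>\<bar> * \<beta>\<^sup>2) * R ^ 3"
  proof -
    have m1: "\<bar>M 1 t\<bar> \<le> R" and m2: "\<bar>M 2 t\<bar> \<le> R\<^sup>2" and m3: "\<bar>M 3 t\<bar> \<le> R ^ 3"
      using MR[of 1 t] MR[of 2 t] MR[of 3 t] by auto
    have m11: "\<bar>(M 1 t)\<^sup>2\<bar> \<le> R\<^sup>2" unfolding power_abs by (intro power_mono m1) simp
    have m111: "\<bar>M 1 t ^ 3\<bar> \<le> R ^ 3" unfolding power_abs by (intro power_mono m1) simp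
    have m12: "\<bar>M 1 t * M 2 t\<bar> \<le> R ^ 3"
      using mult_mono[OF m1 m2] R(1) by (simp add: abs_mult power2_eq_square power3_eq_cube)
    have v: "\<bar>M 1 t * (M 2 t - (M 1 t)\<^sup>2)\<bar> \<le> 2 * R ^ 3"
    proof -
      have "M 1 t * (M 2 t - (M 1 t)\<^sup>2) = M 1 t * M 2 t - M 1 t ^ 3"
        by (simp add: algebra_simps power2_eq_square power3_eq_cube)
      then show ?thesis using m12 m111 by linarith
    qed
    have u: "\<bar>M 3 t - 3 * M 1 t * M 2 t + 2 * M 1 t ^ 3\<bar> \<le> 6 * R ^ 3"
      using m12 m111 m3 by linarith
    have "\<bar>D 3 t\<bar> \<le> \<bar>\<tau> ^ 3 * sin (\<phi> t) * M 1 t ^ 3\<bar> + \<bar>3 * \<tau>\<^sup>2 * \<beta> * cos (\<phi> t) * (M 1 t * (M 2 t - (M 1 t)\<^sup>2))\<bar>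
        + \<bar>\<tau> * \<beta>\<^sup>2 * sin (\<phi> t) * (M 3 t - 3 * M 1 t * M 2 t + 2 * M 1 t ^ 3)\<bar>"
      unfolding D_def by simp
    also have "\<bar>\<tau> ^ 3 * sin (\<phi> t) * M 1 t ^ 3\<bar> \<le> \<bar>\<tau>\<bar> ^ 3 * 1 * R ^ 3"
      unfolding abs_mult power_abs[of \<tau>] by (intro mult_mono m111) auto
    also have "\<bar>3 * \<tau>\<^sup>2 * \<beta> * cos (\<phi> t) * (M 1 t * (M 2 t - (M 1 t)\<^sup>2))\<bar> \<le> (3 * \<tau>\<^sup>2 * \<beta>) * 1 * (2 * R ^ 3)"
      unfolding abs_mult[of "_ * cos _"] abs_mult[of _ "cos _"]
      by (intro mult_mono v) (use \<beta> R in \<open>auto simp: abs_mult\<close>)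
    also have "\<bar>\<tau> * \<beta>\<^sup>2 * sin (\<phi> t) * (M 3 t - 3 * M 1 t * M 2 t + 2 * M 1 t ^ 3)\<bar> \<le> (\<bar>\<tau>\<bar> * \<beta>\<^sup>2) * 1 * (6 * R ^ 3)"
      unfolding abs_mult[of "_ * sin _"] abs_mult[of _ "sin _"]
      by (intro mult_mono u) (use \<beta> R in \<open>auto simp: abs_mult\<close>)
    finally show ?thesis by (simp add: algebra_simps)
  qed
  also have "\<dots> \<le> (\<bar>\<tau>\<bar> ^ 3 + 6 * \<tau>\<^sup>2 * \<beta> + 6 * \<bar>\<tau>\<bar> * \<beta>\<^sup>2) * (\<Sum>l\<in>L. \<bar>y l\<bar> ^ 3)"
    by (rule mult_left_mono[OF R3]) (use \<beta> in auto)
  finally have D3: "\<bar>D 3 t / 6\<bar> \<le> (\<bar>\<tau>\<bar> ^ 3 + 6 * \<tau>\<^sup>2 * \<beta> + 6 * \<bar>\<tau>\<bar> * \<beta>\<^sup>2) / 6 * (\<Sum>l\<in>L. \<bar>y l\<bar> ^ 3)"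
    by simp
  have "\<phi> 0 = v" "\<And>q. M q 0 = m q" by (simp_all add: \<phi>_def v_def P_def M_def m_def)
  then have "D 0 0 + D 1 0 + D 2 0 / 2 = cos v - \<tau> * sin v * m 1 - (\<tau>\<^sup>2 * cos v * (m 1)\<^sup>2 + \<tau> * \<beta> * sin v * (m 2 - (m 1)\<^sup>2)) / 2"
    by (simp add: D_def field_simps)
  moreover have "cos (\<phi> 1) = cos (\<tau> * (ln (\<Sum>l\<in>L. A l * exp (\<beta> * y l)) / \<beta>) + \<theta>)"
    by (simp add: \<phi>_def P_def)
  ultimately have "cos (\<tau> * (ln (\<Sum>l\<in>L. A l * exp (\<beta> * y l)) / \<beta>) + \<theta>)
      - (cos v - \<tau> * sin v * m 1 - (\<tau>\<^sup>2 * cos v * (m 1)\<^sup>2 + \<tau> * \<beta> * sin v * (m 2 - (m 1)\<^sup>2)) / 2) = D 3 t / 6"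
    using t by linarith
  with D3 show ?thesis by (simp only:)
qed

section \<open>The replacement method\<close>

text \<open>
  All that the replacement argument uses about the law of a step vector: it is centred, has covariance
  \<open>C\<close>, and its coordinates have third absolute moments at most \<open>\<rho>\<close>.
\<close>

definition step_law :: "nat \<Rightarrow> (nat \<Rightarrow> nat \<Rightarrow> real) \<Rightarrow> real \<Rightarrow> (nat \<Rightarrow> real) measure \<Rightarrow> bool" where
  "step_law k C \<rho> P \<longleftrightarrow> prob_space P \<and> sets P = sets (PiM {1..k} (\<lambda>_. borel)) \<and>
     (\<forall>l\<in>{1..k}. integrable P (\<lambda>y. \<bar>y l\<bar> ^ 3) \<and> (\<integral>y. \<bar>y l\<bar> ^ 3 \<partial>P) \<le> \<rho> \<and> (\<integral>y. y l \<partial>P) = 0) \<and>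
     (\<forall>l\<in>{1..k}. \<forall>l'\<in>{1..k}. (\<integral>y. y l * y l' \<partial>P) = C l l')"

text \<open>
  The Taylor polynomial is quadratic in the step, so its expectation involves the law of the step only
  through the covariance \<open>C\<close>. Two step laws with the same \<open>C\<close> are therefore compared with the same
  number.
\<close>

lemma step_law_taylor:
  fixes \<tau> \<theta> \<beta> :: real
  assumes P: "step_law k C \<rho> P" and A: "\<And>l. 0 \<le> A l" "\<exists>l\<in>{1..k}. 0 < A l" and \<beta>: "0 < \<beta>"
  defines "v \<equiv> \<tau> * (ln (\<Sum>l=1..k. A l) / \<beta>) + \<theta>" and "w \<equiv> \<lambda>l. A l / (\<Sum>l=1..k. A l)"
  shows "\<bar>(\<integral>y. cos (\<tau> * (ln (\<Sum>l=1..k. A l * exp (\<beta> * y l)) / \<beta>) + \<theta>) \<partial>P)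
      - (cos v - (\<tau>\<^sup>2 * cos v - \<tau> * \<beta> * sin v) / 2 * (\<Sum>l=1..k. \<Sum>l'=1..k. w l * w l' * C l l')
         - \<tau> * \<beta> * sin v / 2 * (\<Sum>l=1..k. w l * C l l))\<bar>
    \<le> (\<bar>\<tau>\<bar> ^ 3 + 6 * \<tau>\<^sup>2 * \<beta> + 6 * \<bar>\<tau>\<bar> * \<beta>\<^sup>2) / 6 * (real k * \<rho>)"
proof -
  interpret prob_space P using P by (simp add: step_law_def)
  have sets: "sets P = sets (PiM {1..k} (\<lambda>_. borel))"
    and I3: "\<And>l. l \<in> {1..k} \<Longrightarrow> integrable P (\<lambda>y. \<bar>y l\<bar> ^ 3)"
    and \<rho>: "\<And>l. l \<in> {1..k} \<Longrightarrow> (\<integral>y. \<bar>y l\<bar> ^ 3 \<partial>P) \<le> \<rho>"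
    and E1: "\<And>l. l \<in> {1..k} \<Longrightarrow> (\<integral>y. y l \<partial>P) = 0"
    and E2: "\<And>l l'. l \<in> {1..k} \<Longrightarrow> l' \<in> {1..k} \<Longrightarrow> (\<integral>y. y l * y l' \<partial>P) = C l l'"
    using P by (auto simp: step_law_def)
  have meas: "(\<lambda>y. y l) \<in> borel_measurable P" if "l \<in> {1..k}" for l
    using that unfolding measurable_cong_sets[OF sets refl] by (rule measurable_component_singleton)
  have sq: "y\<^sup>2 \<le> 1 + \<bar>y\<bar> ^ 3" for y :: real
  proof (cases "\<bar>y\<bar> \<le> 1")
    case True
    then have "y\<^sup>2 \<le> 1" by (simp add: abs_square_le_1)
    then show ?thesis using zero_le_power[of "\<bar>y\<bar>" 3] by linarith
  next
    case False
    then have "\<bar>y\<bar>\<^sup>2 \<le> \<bar>y\<bar> ^ 3" by (intro power_increasing) auto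
    then show ?thesis by simp
  qed
  have I1: "integrable P (\<lambda>y. y l)" if l: "l \<in> {1..k}" for l
  proof (rule Bochner_Integration.integrable_bound[of _ "\<lambda>y. 2 + \<bar>y l\<bar> ^ 3"])
    show "integrable P (\<lambda>y. 2 + \<bar>y l\<bar> ^ 3)" using I3[OF l] by simp
    have "\<bar>y l\<bar> \<le> 1 + (y l)\<^sup>2" for y :: "nat \<Rightarrow> real"
      using sum_squares_ge_zero[of "\<bar>y l\<bar> - 1" 0] by (simp add: power2_eq_square algebra_simps abs_if split: if_splits)
    then have "\<bar>y l\<bar> \<le> 2 + \<bar>y l\<bar> ^ 3" for y :: "nat \<Rightarrow> real" using sq[of "y l"] by (smt (verit))
    then show "AE y in P. norm (y l) \<le> norm (2 + \<bar>y l\<bar> ^ 3)" by simp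
  qed (rule meas[OF l])
  have I2: "integrable P (\<lambda>y. y l * y l')" if l: "l \<in> {1..k}" "l' \<in> {1..k}" for l l'
  proof (rule Bochner_Integration.integrable_bound[of _ "\<lambda>y. 2 + \<bar>y l\<bar> ^ 3 + \<bar>y l'\<bar> ^ 3"])
    show "integrable P (\<lambda>y. 2 + \<bar>y l\<bar> ^ 3 + \<bar>y l'\<bar> ^ 3)" using I3 l by simp
    have "\<bar>y l * y l'\<bar> \<le> (y l)\<^sup>2 + (y l')\<^sup>2" for y :: "nat \<Rightarrow> real"
      using sum_squares_bound[of "\<bar>y l\<bar>" "\<bar>y l'\<bar>"] abs_ge_zero[of "y l * y l'"] unfolding abs_mult power2_abs by linarith
    then have "\<bar>y l * y l'\<bar> \<le> 2 + \<bar>y l\<bar> ^ 3 + \<bar>y l'\<bar> ^ 3" for y :: "nat \<Rightarrow> real"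
      using sq[of "y l"] sq[of "y l'"] by (smt (verit))
    then show "AE y in P. norm (y l * y l') \<le> norm (2 + \<bar>y l\<bar> ^ 3 + \<bar>y l'\<bar> ^ 3)" by simp
  qed (use meas l in measurable)
  define S where "S = (\<Sum>l=1..k. A l)"
  have w_sum: "(\<Sum>l=1..k. A l * z l) / S = (\<Sum>l=1..k. w l * z l)" for z
    unfolding w_def S_def[symmetric] by (simp add: sum_divide_distrib)
  define c where "c = (\<bar>\<tau>\<bar> ^ 3 + 6 * \<tau>\<^sup>2 * \<beta> + 6 * \<bar>\<tau>\<bar> * \<beta>\<^sup>2) / 6"
  have c: "0 \<le> c" using \<beta> by (simp add: c_def)
  define f where "f y = cos (\<tau> * (ln (\<Sum>l=1..k. A l * exp (\<beta> * y l)) / \<beta>) + \<theta>)" for y :: "nat \<Rightarrow> real"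
  define a b where "a = (\<tau>\<^sup>2 * cos v - \<tau> * \<beta> * sin v) / 2" and "b = \<tau> * \<beta> * sin v / 2"
  define T where "T y = cos v + (\<Sum>l=1..k. (- (\<tau> * sin v) * w l) * y l)
      + (\<Sum>l=1..k. \<Sum>l'=1..k. (- a * (w l * w l')) * (y l * y l'))
      + (\<Sum>l=1..k. (- b * w l) * (y l * y l))" for y :: "nat \<Rightarrow> real"
  have fT: "\<bar>f y - T y\<bar> \<le> c * (\<Sum>l=1..k. \<bar>y l\<bar> ^ 3)" for y
  proof -
    define m1 m2 where "m1 = (\<Sum>l=1..k. w l * y l)" and "m2 = (\<Sum>l=1..k. w l * (y l)\<^sup>2)"
    have sq1: "m1\<^sup>2 = (\<Sum>l=1..k. \<Sum>l'=1..k. (w l * w l') * (y l * y l'))"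
      unfolding m1_def power2_eq_square sum_product by (intro sum.cong refl) (simp add: ac_simps)
    have "T y = cos v - \<tau> * sin v * m1 - a * m1\<^sup>2 - b * m2"
      unfolding T_def sq1 unfolding m1_def m2_def sum_distrib_left power2_eq_square
      by (simp add: sum_negf ac_simps)
    also have "\<dots> = cos v - \<tau> * sin v * m1 - (\<tau>\<^sup>2 * cos v * m1\<^sup>2 + \<tau> * \<beta> * sin v * (m2 - m1\<^sup>2)) / 2"
      by (simp add: a_def b_def field_simps)
    finally show ?thesis
      using cos_log_sum_exp_taylor[of "{1..k}" A \<beta> \<tau> y \<theta>] A \<beta>
      unfolding S_def[symmetric] w_sum power_one_right
      unfolding m1_def m2_def f_def c_def v_def S_def by simp
  qed
  have [measurable]: "(\<lambda>y. \<Sum>l=1..k. A l * exp (\<beta> * y l)) \<in> borel_measurable P"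
  proof (rule borel_measurable_sum)
    fix l assume "l \<in> {1..k}"
    note meas[OF this, measurable]
    show "(\<lambda>y. A l * exp (\<beta> * y l)) \<in> borel_measurable P" by measurable
  qed
  have "f \<in> borel_measurable P" unfolding f_def by measurable
  then have If: "integrable P f"
    by (rule integrable_const_bound[of _ 1, rotated]) (simp add: f_def)
  have HT: "has_bochner_integral P T (cos v + (\<Sum>l=1..k. (- (\<tau> * sin v) * w l) * 0)
      + (\<Sum>l=1..k. \<Sum>l'=1..k. (- a * (w l * w l')) * C l l')
      + (\<Sum>l=1..k. (- b * w l) * C l l))"
    unfolding T_def
    by (intro has_bochner_integral_add has_bochner_integral_sum has_bochner_integral_mult_right)
      (use I1 I2 E1 E2 in \<open>auto simp: has_bochner_integral_iff prob_space\<close>)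
  have "\<bar>integral\<^sup>L P f - integral\<^sup>L P T\<bar> = \<bar>\<integral>y. f y - T y \<partial>P\<bar>"
    using If HT by (simp add: has_bochner_integral_iff)
  also have "\<dots> \<le> (\<integral>y. \<bar>f y - T y\<bar> \<partial>P)" by (rule integral_abs_bound)
  also have "\<dots> \<le> (\<integral>y. c * (\<Sum>l=1..k. \<bar>y l\<bar> ^ 3) \<partial>P)"
    using If HT I3 fT by (intro integral_mono) (auto simp: has_bochner_integral_iff)
  also have "\<dots> = c * (\<Sum>l=1..k. \<integral>y. \<bar>y l\<bar> ^ 3 \<partial>P)" using I3 by simp
  also have "\<dots> \<le> c * (\<Sum>l=1..k. \<rho>)" using c \<rho> by (intro mult_left_mono sum_mono) auto
  finally have "\<bar>integral\<^sup>L P f - integral\<^sup>L P T\<bar> \<le> c * (real k * \<rho>)" by simp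
  moreover have "integral\<^sup>L P T = cos v - a * (\<Sum>l=1..k. \<Sum>l'=1..k. w l * w l' * C l l') - b * (\<Sum>l=1..k. w l * C l l)"
    unfolding has_bochner_integral_integral_eq[OF HT] by (simp add: sum_distrib_left sum_negf ac_simps)
  ultimately show ?thesis by (simp only: f_def[abs_def] c_def a_def b_def)
qed

lemma (in prob_space) abs_integral_le_const:
  fixes f :: "'a \<Rightarrow> real"
  assumes "\<And>x. \<bar>f x\<bar> \<le> b"
  shows "\<bar>integral\<^sup>L M f\<bar> \<le> b"
proof (cases "integrable M f")
  case True
  have "\<bar>integral\<^sup>L M f\<bar> \<le> (\<integral>x. \<bar>f x\<bar> \<partial>M)" by (rule integral_abs_bound)
  also have "\<dots> \<le> b" using True assms by (intro integral_le_const) auto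
  finally show ?thesis .
next
  case False
  then show ?thesis using assms[of undefined] by (simp add: not_integrable_integral_eq)
qed

text \<open>
  The factors of the product measure are exchanged one at a time. In the induction step the coordinate
  \<open>i\<close> is integrated out against \<open>P i\<close>; by Fubini the function obtained still satisfies the
  one-coordinate hypothesis with the same \<open>\<epsilon>\<close>.
\<close>

lemma lindeberg_replacement:
  fixes G :: "('i \<Rightarrow> 'b) \<Rightarrow> real"
  assumes "finite I" and P: "\<And>i. prob_space (P i)" and Q: "\<And>i. prob_space (Q i)"
    and sets: "\<And>i. sets (Q i) = sets (P i)"
    and "G \<in> borel_measurable (PiM I P)" and "\<And>x. \<bar>G x\<bar> \<le> b"
    and "\<And>i x. i \<in> I \<Longrightarrow> x \<in> space (PiM I P) \<Longrightarrow>
           \<bar>(\<integral>y. G (x(i := y)) \<partial>P i) - (\<integral>y. G (x(i := y)) \<partial>Q i)\<bar> \<le> \<epsilon>"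
  shows "\<bar>(\<integral>x. G x \<partial>PiM I P) - (\<integral>x. G x \<partial>PiM I Q)\<bar> \<le> real (card I) * \<epsilon>"
  using assms(1,5-)
proof (induction I arbitrary: G rule: finite_induct)
  case empty
  have "PiM {} Q = PiM {} P" by (simp add: PiM_empty)
  then show ?case by simp
next
  case (insert i I)
  interpret P: product_prob_space P I
    by (simp add: product_prob_space_def product_prob_space_axioms_def product_sigma_finite_def P prob_space_imp_sigma_finite)
  interpret Q: product_prob_space Q I
    by (simp add: product_prob_space_def product_prob_space_axioms_def product_sigma_finite_def Q prob_space_imp_sigma_finite)
  note [measurable] = insert.prems(1)
  have PQ: "sets (PiM J Q) = sets (PiM J P)" for J by (rule sets_PiM_cong) (auto simp: sets)
  have GQ [measurable]: "G \<in> borel_measurable (PiM (insert i I) Q)"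
    using insert.prems(1) by (simp add: measurable_cong_sets[OF PQ refl])
  interpret PIi: prob_space "PiM (insert i I) P" by (rule prob_space_PiM) (rule P)
  interpret QIi: prob_space "PiM (insert i I) Q" by (rule prob_space_PiM) (rule Q)
  define G\<^sub>P where "G\<^sub>P x = (\<integral>y. G (x(i := y)) \<partial>P i)" for x
  define G\<^sub>Q where "G\<^sub>Q x = (\<integral>y. G (x(i := y)) \<partial>Q i)" for x
  have GP [measurable]: "G\<^sub>P \<in> borel_measurable (PiM I P)" unfolding G\<^sub>P_def by measurable
  have GQm: "G\<^sub>Q \<in> borel_measurable (PiM I Q)" unfolding G\<^sub>Q_def by measurable
  have GP' [measurable]: "G\<^sub>P \<in> borel_measurable (PiM I Q)"
    using GP by (simp add: measurable_cong_sets[OF PQ refl])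
  have bP: "\<bar>G\<^sub>P x\<bar> \<le> b" and bQ: "\<bar>G\<^sub>Q x\<bar> \<le> b" for x
    unfolding G\<^sub>P_def G\<^sub>Q_def using insert.prems(2)
    by (auto intro: prob_space.abs_integral_le_const[OF P] prob_space.abs_integral_le_const[OF Q])
  have "(\<integral>x. G x \<partial>PiM (insert i I) P) = (\<integral>x. G\<^sub>P x \<partial>PiM I P)"
    unfolding G\<^sub>P_def using insert by (intro P.product_integral_insert PIi.integrable_const_bound[of _ b]) auto
  moreover have "(\<integral>x. G x \<partial>PiM (insert i I) Q) = (\<integral>x. G\<^sub>Q x \<partial>PiM I Q)"
    unfolding G\<^sub>Q_def using insert GQ by (intro Q.product_integral_insert QIi.integrable_const_bound[of _ b]) auto
  moreover have "\<bar>(\<integral>x. G\<^sub>P x \<partial>PiM I P) - (\<integral>x. G\<^sub>P x \<partial>PiM I Q)\<bar> \<le> real (card I) * \<epsilon>"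
  proof (rule insert.IH[OF GP bP])
    fix i' x assume i': "i' \<in> I" and x: "x \<in> space (PiM I P)"
    have swap: "(\<integral>z. G\<^sub>P (x(i' := z)) \<partial>R) = (\<integral>y. (\<integral>z. G (x(i := y, i' := z)) \<partial>R) \<partial>P i)
        \<and> integrable (P i) (\<lambda>y. \<integral>z. G (x(i := y, i' := z)) \<partial>R)"
      if R: "prob_space R" and sR: "sets R = sets (P i')" for R
    proof -
      interpret R: prob_space R by fact
      interpret pair_prob_space R "P i" ..
      have ne: "i' \<noteq> i" using i' insert.hyps by auto
      have cR: "measurable (R \<Otimes>\<^sub>M P i) N = measurable (P i' \<Otimes>\<^sub>M P i) N" for N :: "'c measure"
        by (intro measurable_cong_sets sets_pair_measure_cong sR refl)
      have x2 [measurable]: "(\<lambda>p. x) \<in> measurable (P i' \<Otimes>\<^sub>M P i) (PiM I P)" using x by simp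
      have "(\<lambda>p. (x, fst p)) \<in> measurable (P i' \<Otimes>\<^sub>M P i) (PiM I P \<Otimes>\<^sub>M P i')" by measurable
      from measurable_compose[OF this measurable_add_dim] i'
      have 1: "(\<lambda>p. x(i' := fst p)) \<in> measurable (P i' \<Otimes>\<^sub>M P i) (PiM I P)" by (simp add: insert_absorb)
      then have "(\<lambda>p. (x(i' := fst p), snd p)) \<in> measurable (P i' \<Otimes>\<^sub>M P i) (PiM I P \<Otimes>\<^sub>M P i)" by measurable
      from measurable_compose[OF this measurable_add_dim]
      have "(\<lambda>p. x(i' := fst p, i := snd p)) \<in> measurable (P i' \<Otimes>\<^sub>M P i) (PiM (insert i I) P)" by simp
      then have "(\<lambda>p. G (x(i' := fst p, i := snd p))) \<in> borel_measurable (R \<Otimes>\<^sub>M P i)"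
        unfolding cR by measurable
      then have int: "integrable (R \<Otimes>\<^sub>M P i) (\<lambda>(z, y). G (x(i' := z, i := y)))"
        using insert.prems(2) by (intro P.integrable_const_bound[of _ b]) (auto simp: case_prod_beta')
      have tw: "x(i' := z, i := y) = x(i := y, i' := z)" for y z using ne by (rule fun_upd_twist)
      have "(\<integral>z. G\<^sub>P (x(i' := z)) \<partial>R) = (\<integral>y. (\<integral>z. G (x(i' := z, i := y)) \<partial>R) \<partial>P i)"
        unfolding G\<^sub>P_def by (rule Fubini_integral[OF int, symmetric])
      then show ?thesis using integrable_snd[OF int] by (simp add: tw)
    qed
    note s1 = swap[OF P refl] and s2 = swap[OF Q sets]
    have "\<bar>(\<integral>z. G\<^sub>P (x(i' := z)) \<partial>P i') - (\<integral>z. G\<^sub>P (x(i' := z)) \<partial>Q i')\<bar>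
       = \<bar>\<integral>y. (\<integral>z. G (x(i := y, i' := z)) \<partial>P i') - (\<integral>z. G (x(i := y, i' := z)) \<partial>Q i') \<partial>P i\<bar>"
      using s1 s2 by simp
    also have "\<dots> \<le> (\<integral>y. \<bar>(\<integral>z. G (x(i := y, i' := z)) \<partial>P i') - (\<integral>z. G (x(i := y, i' := z)) \<partial>Q i')\<bar> \<partial>P i)"
      by (rule integral_abs_bound)
    also have "\<dots> \<le> (\<integral>y. \<epsilon> \<partial>P i)"
    proof (rule integral_mono)
      fix y assume "y \<in> space (P i)"
      then have "x(i := y) \<in> space (PiM (insert i I) P)" using x by (auto simp: space_PiM PiE_def extensional_def)
      then show "\<bar>(\<integral>z. G (x(i := y, i' := z)) \<partial>P i') - (\<integral>z. G (x(i := y, i' := z)) \<partial>Q i')\<bar> \<le> \<epsilon>"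
        by (rule insert.prems(3)[OF insertI2[OF i']])
    qed (use s1 s2 in auto)
    finally show "\<bar>(\<integral>z. G\<^sub>P (x(i' := z)) \<partial>P i') - (\<integral>z. G\<^sub>P (x(i' := z)) \<partial>Q i')\<bar> \<le> \<epsilon>"
      by (simp add: prob_space.prob_space[OF P])
  qed
  moreover have "\<bar>(\<integral>x. G\<^sub>P x \<partial>PiM I Q) - (\<integral>x. G\<^sub>Q x \<partial>PiM I Q)\<bar> \<le> \<epsilon>"
  proof -
    have I: "integrable (PiM I Q) G\<^sub>P" "integrable (PiM I Q) G\<^sub>Q"
      using bP bQ GQm by (auto intro!: Q.P.integrable_const_bound[of _ b])
    have "\<bar>(\<integral>x. G\<^sub>P x \<partial>PiM I Q) - (\<integral>x. G\<^sub>Q x \<partial>PiM I Q)\<bar> = \<bar>\<integral>x. G\<^sub>P x - G\<^sub>Q x \<partial>PiM I Q\<bar>"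
      using I by simp
    also have "\<dots> \<le> (\<integral>x. \<bar>G\<^sub>P x - G\<^sub>Q x\<bar> \<partial>PiM I Q)" by (rule integral_abs_bound)
    also have "\<dots> \<le> (\<integral>x. \<epsilon> \<partial>PiM I Q)"
    proof (rule integral_mono)
      fix x assume "x \<in> space (PiM I Q)"
      then have x: "x \<in> space (PiM I P)" using sets_eq_imp_space_eq[OF PQ[of I]] by simp
      obtain y where y: "y \<in> space (P i)" using prob_space.not_empty[OF P] by blast
      have "x(i := y) \<in> space (PiM (insert i I) P)" using x y by (auto simp: space_PiM PiE_def extensional_def)
      from insert.prems(3)[OF insertI1 this] show "\<bar>G\<^sub>P x - G\<^sub>Q x\<bar> \<le> \<epsilon>" by (simp only: G\<^sub>P_def G\<^sub>Q_def fun_upd_upd)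
    qed (use I in auto)
    finally show ?thesis by (simp add: Q.P.prob_space)
  qed
  ultimately show ?case using insert.hyps by (simp add: algebra_simps)
qed

lemma measurable_path_sum:
  assumes "\<And>i l. i \<in> {1..n} \<Longrightarrow> l \<in> {1..k} \<Longrightarrow> (\<lambda>\<omega>. x \<omega> i l) \<in> borel_measurable M" and "\<pi> \<in> increasing_paths n k"
  shows "(\<lambda>\<omega>. path_sum n (x \<omega>) \<pi>) \<in> borel_measurable M"
  unfolding path_sum_def using assms increasing_paths_range by (intro borel_measurable_sum) blast

lemma measurable_path_max:
  assumes "\<And>i l. i \<in> {1..n} \<Longrightarrow> l \<in> {1..k} \<Longrightarrow> (\<lambda>\<omega>. x \<omega> i l) \<in> borel_measurable M"
  shows "(\<lambda>\<omega>. path_max n k (x \<omega>)) \<in> borel_measurable M"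
  unfolding path_max_def using measurable_path_sum[of n k x M, OF assms]
  by (intro borel_measurable_Max) auto

lemma measurable_soft_max:
  assumes "\<And>i l. i \<in> {1..n} \<Longrightarrow> l \<in> {1..k} \<Longrightarrow> (\<lambda>\<omega>. x \<omega> i l) \<in> borel_measurable M"
  shows "(\<lambda>\<omega>. soft_max \<beta> n k (x \<omega>)) \<in> borel_measurable M"
proof -
  have [measurable]: "(\<lambda>\<omega>. \<Sum>\<pi>\<in>increasing_paths n k. exp (\<beta> * path_sum n (x \<omega>) \<pi>)) \<in> borel_measurable M"
  proof (rule borel_measurable_sum)
    fix \<pi> assume "\<pi> \<in> increasing_paths n k"
    note measurable_path_sum[of n k x M, OF assms this, measurable]
    show "(\<lambda>\<omega>. exp (\<beta> * path_sum n (x \<omega>) \<pi>)) \<in> borel_measurable M" by measurable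
  qed
  show ?thesis unfolding soft_max_def by measurable
qed

lemma soft_max_lindeberg:
  assumes P: "\<And>i. step_law k C \<rho> (P i)" and Q: "\<And>i. step_law k C \<rho> (Q i)"
    and k: "1 \<le> k" and \<beta>: "0 < \<beta>"
  shows "\<bar>(\<integral>x. cos (\<tau> * soft_max \<beta> n k x + \<theta>) \<partial>PiM {1..n} P) - (\<integral>x. cos (\<tau> * soft_max \<beta> n k x + \<theta>) \<partial>PiM {1..n} Q)\<bar>
    \<le> real n * ((\<bar>\<tau>\<bar> ^ 3 + 6 * \<tau>\<^sup>2 * \<beta> + 6 * \<bar>\<tau>\<bar> * \<beta>\<^sup>2) / 3 * (real k * \<rho>))"
proof -
  have sP: "sets (P i) = sets (PiM {1..k} (\<lambda>_. borel))" and sQ: "sets (Q i) = sets (PiM {1..k} (\<lambda>_. borel))" for i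
    using P Q by (auto simp: step_law_def)
  have coord: "(\<lambda>x. x i l) \<in> borel_measurable (PiM {1..n} P)" if "i \<in> {1..n}" "l \<in> {1..k}" for i l
  proof -
    have "(\<lambda>y. y l) \<in> borel_measurable (P i)"
      using that(2) unfolding measurable_cong_sets[OF sP refl] by (rule measurable_component_singleton)
    from measurable_compose[OF measurable_component_singleton[OF that(1), of P] this] show ?thesis .
  qed
  have "\<bar>(\<integral>x. cos (\<tau> * soft_max \<beta> n k x + \<theta>) \<partial>PiM {1..n} P) - (\<integral>x. cos (\<tau> * soft_max \<beta> n k x + \<theta>) \<partial>PiM {1..n} Q)\<bar>
    \<le> real (card {1..n}) * ((\<bar>\<tau>\<bar> ^ 3 + 6 * \<tau>\<^sup>2 * \<beta> + 6 * \<bar>\<tau>\<bar> * \<beta>\<^sup>2) / 3 * (real k * \<rho>))"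
  proof (rule lindeberg_replacement)
    note measurable_soft_max[of n k "\<lambda>x. x", OF coord, measurable]
    show "(\<lambda>x. cos (\<tau> * soft_max \<beta> n k x + \<theta>)) \<in> borel_measurable (PiM {1..n} P)" by measurable
    show "\<bar>cos (\<tau> * soft_max \<beta> n k x + \<theta>)\<bar> \<le> 1" for x by simp
    fix i and x :: "nat \<Rightarrow> nat \<Rightarrow> real" assume i: "i \<in> {1..n}"
    obtain A :: "nat \<Rightarrow> real" where A: "\<And>l. 0 \<le> A l" "\<exists>l\<in>{1..k}. 0 < A l"
      "\<And>y. soft_max \<beta> n k (x(i := y)) = ln (\<Sum>l=1..k. A l * exp (\<beta> * y l)) / \<beta>"
      using soft_max_step[OF k i] by metis
    show "\<bar>(\<integral>y. cos (\<tau> * soft_max \<beta> n k (x(i := y)) + \<theta>) \<partial>P i) - (\<integral>y. cos (\<tau> * soft_max \<beta> n k (x(i := y)) + \<theta>) \<partial>Q i)\<bar>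
      \<le> (\<bar>\<tau>\<bar> ^ 3 + 6 * \<tau>\<^sup>2 * \<beta> + 6 * \<bar>\<tau>\<bar> * \<beta>\<^sup>2) / 3 * (real k * \<rho>)"
      unfolding A(3)
      using step_law_taylor[OF P A(1,2) \<beta>, of i \<tau> \<theta>] step_law_taylor[OF Q A(1,2) \<beta>, of i \<tau> \<theta>] by linarith
  qed (use P Q sP sQ in \<open>auto simp: step_law_def\<close>)
  then show ?thesis by simp
qed

lemma cos_affine_lipschitz: "\<bar>cos (\<tau> * a + \<theta>) - cos (\<tau> * b + \<theta>)\<bar> \<le> \<bar>\<tau>\<bar> * \<bar>a - b\<bar>" for \<tau> \<theta> a b :: real
proof -
  have "\<bar>cos u - cos v\<bar> \<le> \<bar>u - v\<bar>" for u v :: real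
  proof -
    have "\<bar>cos u - cos v\<bar> = 2 * \<bar>sin ((u + v) / 2)\<bar> * \<bar>sin ((v - u) / 2)\<bar>"
      by (simp add: cos_diff_cos abs_mult)
    also have "\<dots> \<le> 2 * 1 * \<bar>(v - u) / 2\<bar>"
      by (intro mult_mono abs_sin_x_le_abs_x) auto
    finally show ?thesis by simp
  qed
  from this[of "\<tau> * a + \<theta>" "\<tau> * b + \<theta>"] show ?thesis
    by (simp add: right_diff_distrib[symmetric] abs_mult)
qed

text \<open>
  The first error term comes from the exchange of \<open>n\<close> steps, the second from smoothing the maximum
  in both expectations. The parameter \<open>\<beta>\<close> balances them.
\<close>

lemma path_max_lindeberg:
  assumes M: "prob_space M" "prob_space.indep_vars M (\<lambda>_. PiM {1..k} (\<lambda>_. borel)) Y {1..n}"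
      "\<And>i. i \<in> {1..n} \<Longrightarrow> step_law k C \<rho> (distr M (PiM {1..k} (\<lambda>_. borel)) (Y i))"
    and N: "prob_space N" "prob_space.indep_vars N (\<lambda>_. PiM {1..k} (\<lambda>_. borel)) Z {1..n}"
      "\<And>i. i \<in> {1..n} \<Longrightarrow> step_law k C \<rho> (distr N (PiM {1..k} (\<lambda>_. borel)) (Z i))"
    and n: "1 \<le> n" and k: "1 \<le> k" and \<beta>: "0 < \<beta>"
  shows "\<bar>(\<integral>\<omega>. cos (\<tau> * path_max n k (\<lambda>i. Y i \<omega>) + \<theta>) \<partial>M) - (\<integral>\<omega>. cos (\<tau> * path_max n k (\<lambda>i. Z i \<omega>) + \<theta>) \<partial>N)\<bar>
    \<le> real n * ((\<bar>\<tau>\<bar> ^ 3 + 6 * \<tau>\<^sup>2 * \<beta> + 6 * \<bar>\<tau>\<bar> * \<beta>\<^sup>2) / 3 * (real k * \<rho>)) + 2 * \<bar>\<tau>\<bar> * (real k * ln (real n + 1) / \<beta>)"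
proof -
  let ?R = "PiM {1..k} (\<lambda>_. borel) :: (nat \<Rightarrow> real) measure"
  \<comment> \<open>Product measures need a probability measure at every index; those outside \<open>{1..n}\<close> are filled with the law of the first step.\<close>
  have repr: "(\<integral>\<omega>. cos (\<tau> * soft_max \<beta> n k (\<lambda>i. Y i \<omega>) + \<theta>) \<partial>M)
       = (\<integral>x. cos (\<tau> * soft_max \<beta> n k x + \<theta>) \<partial>PiM {1..n} (\<lambda>i. distr M ?R (Y (if i \<in> {1..n} then i else 1))))
     \<and> \<bar>(\<integral>\<omega>. cos (\<tau> * path_max n k (\<lambda>i. Y i \<omega>) + \<theta>) \<partial>M) - (\<integral>\<omega>. cos (\<tau> * soft_max \<beta> n k (\<lambda>i. Y i \<omega>) + \<theta>) \<partial>M)\<bar>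
      \<le> \<bar>\<tau>\<bar> * (real k * ln (real n + 1) / \<beta>)"
    if M: "prob_space M" "prob_space.indep_vars M (\<lambda>_. ?R) Y {1..n}" for M :: "'z measure" and Y
  proof
    interpret prob_space M by fact
    have Ym: "Y i \<in> measurable M ?R" if "i \<in> {1..n}" for i
      using M(2) that by (auto simp: indep_vars_def)
    have coordY: "(\<lambda>\<omega>. Y i \<omega> l) \<in> borel_measurable M" if "i \<in> {1..n}" "l \<in> {1..k}" for i l
      by (rule measurable_compose[OF Ym[OF that(1)] measurable_component_singleton[OF that(2)]])
    have coord: "(\<lambda>x. x i l) \<in> borel_measurable (PiM {1..n} (\<lambda>_. ?R))" if "i \<in> {1..n}" "l \<in> {1..k}" for i l
      by (rule measurable_compose[OF measurable_component_singleton[OF that(1)] measurable_component_singleton[OF that(2)]])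
    have "PiM {1..n} (\<lambda>i. distr M ?R (Y (if i \<in> {1..n} then i else 1))) = PiM {1..n} (\<lambda>i. distr M ?R (Y i))"
      by (rule PiM_cong) auto
    also have "\<dots> = distr M (PiM {1..n} (\<lambda>_. ?R)) (\<lambda>\<omega>. \<lambda>i\<in>{1..n}. Y i \<omega>)"
      using n Ym M(2) by (subst (asm) indep_vars_iff_distr_eq_PiM') auto
    finally have law: "PiM {1..n} (\<lambda>i. distr M ?R (Y (if i \<in> {1..n} then i else 1)))
      = distr M (PiM {1..n} (\<lambda>_. ?R)) (\<lambda>\<omega>. \<lambda>i\<in>{1..n}. Y i \<omega>)" .
    have restr: "soft_max \<beta> n k (\<lambda>i\<in>{1..n}. Y i \<omega>) = soft_max \<beta> n k (\<lambda>i. Y i \<omega>)" for \<omega>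
      by (simp add: soft_max_def path_sum_def)
    have [measurable]: "(\<lambda>x. soft_max \<beta> n k x) \<in> borel_measurable (PiM {1..n} (\<lambda>_. ?R))"
      by (rule measurable_soft_max[OF coord])
    then have cm: "(\<lambda>x. cos (\<tau> * soft_max \<beta> n k x + \<theta>)) \<in> borel_measurable (PiM {1..n} (\<lambda>_. ?R))"
      by measurable
    have rm: "(\<lambda>\<omega>. \<lambda>i\<in>{1..n}. Y i \<omega>) \<in> measurable M (PiM {1..n} (\<lambda>_. ?R))"
      by (intro measurable_restrict Ym)
    show "(\<integral>\<omega>. cos (\<tau> * soft_max \<beta> n k (\<lambda>i. Y i \<omega>) + \<theta>) \<partial>M)
       = (\<integral>x. cos (\<tau> * soft_max \<beta> n k x + \<theta>) \<partial>PiM {1..n} (\<lambda>i. distr M ?R (Y (if i \<in> {1..n} then i else 1))))"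
      unfolding law integral_distr[OF rm cm] restr ..
    have [measurable]: "(\<lambda>\<omega>. soft_max \<beta> n k (\<lambda>i. Y i \<omega>)) \<in> borel_measurable M"
      "(\<lambda>\<omega>. path_max n k (\<lambda>i. Y i \<omega>)) \<in> borel_measurable M"
      by (rule measurable_soft_max[OF coordY] measurable_path_max[OF coordY]; assumption)+
    have I: "integrable M (\<lambda>\<omega>. cos (\<tau> * path_max n k (\<lambda>i. Y i \<omega>) + \<theta>))"
       "integrable M (\<lambda>\<omega>. cos (\<tau> * soft_max \<beta> n k (\<lambda>i. Y i \<omega>) + \<theta>))"
      by (auto intro!: integrable_const_bound[of _ 1])
    have "\<bar>cos (\<tau> * path_max n k (\<lambda>i. Y i \<omega>) + \<theta>) - cos (\<tau> * soft_max \<beta> n k (\<lambda>i. Y i \<omega>) + \<theta>)\<bar>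
      \<le> \<bar>\<tau>\<bar> * (real k * ln (real n + 1) / \<beta>)" for \<omega>
    proof -
      have "\<bar>cos (\<tau> * path_max n k (\<lambda>i. Y i \<omega>) + \<theta>) - cos (\<tau> * soft_max \<beta> n k (\<lambda>i. Y i \<omega>) + \<theta>)\<bar>
        \<le> \<bar>\<tau>\<bar> * \<bar>path_max n k (\<lambda>i. Y i \<omega>) - soft_max \<beta> n k (\<lambda>i. Y i \<omega>)\<bar>"
        by (rule cos_affine_lipschitz)
      also have "\<dots> \<le> \<bar>\<tau>\<bar> * (real k * ln (real n + 1) / \<beta>)"
        using path_max_le_soft_max[OF \<beta> k, of n "\<lambda>i. Y i \<omega>"] soft_max_le_path_max[OF \<beta> k, of n "\<lambda>i. Y i \<omega>"]
        by (intro mult_left_mono) auto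
      finally show ?thesis .
    qed
    then have "\<bar>\<integral>\<omega>. cos (\<tau> * path_max n k (\<lambda>i. Y i \<omega>) + \<theta>) - cos (\<tau> * soft_max \<beta> n k (\<lambda>i. Y i \<omega>) + \<theta>) \<partial>M\<bar>
      \<le> \<bar>\<tau>\<bar> * (real k * ln (real n + 1) / \<beta>)" by (rule abs_integral_le_const)
    then show "\<bar>(\<integral>\<omega>. cos (\<tau> * path_max n k (\<lambda>i. Y i \<omega>) + \<theta>) \<partial>M) - (\<integral>\<omega>. cos (\<tau> * soft_max \<beta> n k (\<lambda>i. Y i \<omega>) + \<theta>) \<partial>M)\<bar>
      \<le> \<bar>\<tau>\<bar> * (real k * ln (real n + 1) / \<beta>)" using I by simp
  qed
  have "\<bar>(\<integral>x. cos (\<tau> * soft_max \<beta> n k x + \<theta>) \<partial>PiM {1..n} (\<lambda>i. distr M ?R (Y (if i \<in> {1..n} then i else 1))))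
       - (\<integral>x. cos (\<tau> * soft_max \<beta> n k x + \<theta>) \<partial>PiM {1..n} (\<lambda>i. distr N ?R (Z (if i \<in> {1..n} then i else 1))))\<bar>
    \<le> real n * ((\<bar>\<tau>\<bar> ^ 3 + 6 * \<tau>\<^sup>2 * \<beta> + 6 * \<bar>\<tau>\<bar> * \<beta>\<^sup>2) / 3 * (real k * \<rho>))"
    by (rule soft_max_lindeberg[OF M(3) N(3) k \<beta>]) (use n in auto)
  then show ?thesis using repr[OF M(1,2)] repr[OF N(1,2)] by linarith
qed

section \<open>Path maxima on a fine grid\<close>

text \<open>
  The path jumps above \<open>l\<close> right after time \<open>c l\<close>.
\<close>

lemma path_of_thresholds:
  assumes mono: "\<And>l. l < k \<Longrightarrow> c l \<le> c (Suc l)" and c0: "c 0 = 0" and ck: "c k = n"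
  shows "\<exists>\<pi>\<in>increasing_paths n k. \<forall>l\<le>k. level n \<pi> l = c l"
proof -
  have c_mono: "c a \<le> c b" if "a \<le> b" "b \<le> k" for a b
    using that
  proof (induction b rule: dec_induct)
    case (step b)
    then show ?case using mono[of b] by simp
  qed simp
  define \<pi> where "\<pi> i = (LEAST l. i \<le> c l)" for i
  have \<pi>_le: "\<pi> i \<le> l \<longleftrightarrow> i \<le> c l" if "i \<le> n" "l \<le> k" for i l
  proof
    assume "\<pi> i \<le> l"
    moreover have "i \<le> c (\<pi> i)" unfolding \<pi>_def by (rule LeastI[of _ k]) (use ck that in simp)
    ultimately show "i \<le> c l" using c_mono[of "\<pi> i" l] that by simp
  qed (auto simp: \<pi>_def intro: Least_le)
  have path: "restrict \<pi> {1..n} \<in> increasing_paths n k"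
  proof (rule increasing_pathsI)
    fix i assume i: "i \<in> {1..n}"
    then show "\<pi> i \<in> {1..k}" using \<pi>_le[of i k] \<pi>_le[of i 0] c0 ck by auto
  next
    show "mono_on {1..n} \<pi>"
    proof (rule mono_onI)
      fix i i' assume i: "i \<in> {1..n}" "i' \<in> {1..n}" "i \<le> i'"
      have "\<pi> i' \<le> k" using \<pi>_le[of i' k] i ck by auto
      moreover from this have "i' \<le> c (\<pi> i')" using \<pi>_le[of i' "\<pi> i'"] i by auto
      ultimately show "\<pi> i \<le> \<pi> i'" using \<pi>_le[of i "\<pi> i'"] i by auto
    qed
  qed
  have "level n (restrict \<pi> {1..n}) l = c l" if "l \<le> k" for l
  proof -
    have "{i \<in> {1..n}. restrict \<pi> {1..n} i \<le> l} = {1..c l}"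
      using \<pi>_le that c_mono[of l k] ck by auto
    then show ?thesis by (simp add: level_def)
  qed
  with path show ?thesis by blast
qed

lemma sum_increments_telescope:
  fixes h :: "nat \<Rightarrow> real"
  assumes "a \<le> b"
  shows "(\<Sum>i\<in>{a<..b}. h i - h (i - 1)) = h b - h a"
  using assms
proof (induction b rule: dec_induct)
  case (step b)
  have "{a<..Suc b} = insert (Suc b) {a<..b}" using step by auto
  then show ?case using step by simp
qed simp

lemma path_sum_increments:
  assumes \<pi>: "\<pi> \<in> increasing_paths n k"
  shows "path_sum n (\<lambda>i l. f l i - f l (i - 1)) \<pi> = (\<Sum>l=1..k. f l (level n \<pi> l) - f l (level n \<pi> (l - 1)))"
  unfolding path_sum_by_level[OF \<pi>] by (intro sum.cong refl sum_increments_telescope level_mono) simp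

text \<open>
  The levels of a path divided by \<open>n\<close> form a subdivision, so the grid maximum never exceeds the
  continuous one. Conversely an optimal subdivision, rounded down to the grid, is the sequence of levels
  of a path, and by continuity its value tends to the maximum.
\<close>

lemma grid_path_max_tendsto_max_increments:
  fixes w :: "nat \<Rightarrow> real \<Rightarrow> real"
  assumes k: "1 \<le> k" and w: "\<And>l. l \<in> {1..k} \<Longrightarrow> continuous_on {0..1} (w l)"
  shows "(\<lambda>n. path_max n k (\<lambda>i l. w l (real i / real n) - w l (real (i - 1) / real n))) \<longlonglongrightarrow> max_increments k w"
proof -
  obtain t where t: "t \<in> subdivisions k" "max_increments k w = (\<Sum>l=1..k. w l (t l) - w l (t (l - 1)))"
    using max_increments_attained(1)[of k w, OF k w] by blast
  have t_step: "t l \<le> t (Suc l)" if "l < k" for l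
    using t(1) that by (auto simp: subdivisions_def dest: bspec[of _ _ "Suc l"])
  have t01: "t 0 = 0" "t k = 1" using t(1) by (auto simp: subdivisions_def)
  have t_range: "t l \<in> {0..1}" if "l \<le> k" for l
  proof -
    have "t 0 \<le> t l" using that
    proof (induction l)
      case (Suc l) then show ?case using t_step[of l] by simp
    qed simp
    moreover have "t l \<le> t k" using that
    proof (induction l rule: inc_induct)
      case (step l) then show ?case using t_step[of l] by simp
    qed simp
    ultimately show ?thesis using t01 by simp
  qed
  define g where "g n = (\<lambda>i l. w l (real i / real n) - w l (real (i - 1) / real n))" for n :: nat
  \<comment> \<open>The optimal subdivision rounded down to the grid.\<close>
  define c where "c n l = nat \<lfloor>real n * t l\<rfloor>" for n l
  define lower where "lower n = (\<Sum>l=1..k. w l (real (c n l) / real n) - w l (real (c n (l - 1)) / real n))" for n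
  have ge: "lower n \<le> path_max n k (g n)" for n
  proof -
    have "\<exists>\<pi>\<in>increasing_paths n k. \<forall>l\<le>k. level n \<pi> l = c n l"
      by (rule path_of_thresholds)
        (use t01 t_step in \<open>auto simp: c_def intro!: nat_mono floor_mono mult_left_mono\<close>)
    then obtain \<pi> where \<pi>: "\<pi> \<in> increasing_paths n k" "\<And>l. l \<le> k \<Longrightarrow> level n \<pi> l = c n l" by blast
    have "lower n = path_sum n (g n) \<pi>"
      unfolding g_def path_sum_increments[OF \<pi>(1), of "\<lambda>l i. w l (real i / real n)"] lower_def
      by (intro sum.cong refl) (auto simp: \<pi>(2))
    then show ?thesis using path_sum_le_path_max[OF \<pi>(1)] by simp
  qed
  have le: "path_max n k (g n) \<le> max_increments k w" if n: "1 \<le> n" for n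
  proof -
    obtain \<pi> where \<pi>: "\<pi> \<in> increasing_paths n k" "path_max n k (g n) = path_sum n (g n) \<pi>"
      using path_max_attained[OF k] by blast
    have "(\<lambda>l. real (level n \<pi> l) / real n) \<in> subdivisions k"
      using n level_0[OF \<pi>(1)] level_last[OF \<pi>(1)] by (auto simp: subdivisions_def intro!: divide_right_mono level_mono)
    from max_increments_attained(2)[of k w, OF k w this]
    have "path_sum n (g n) \<pi> \<le> max_increments k w"
      unfolding g_def path_sum_increments[OF \<pi>(1), of "\<lambda>l i. w l (real i / real n)"] .
    then show ?thesis by (simp only: \<pi>(2))
  qed
  have lim: "lower \<longlonglongrightarrow> max_increments k w"
  proof -
    have ct: "(\<lambda>n. real (c n l) / real n) \<longlonglongrightarrow> t l" if "l \<le> k" for l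
    proof (rule tendsto_sandwich)
      have t: "0 \<le> t l" using t_range[OF that] by simp
      then have c_real: "real (c n l) = of_int \<lfloor>real n * t l\<rfloor>" for n by (simp add: c_def)
      have "t l - 1 / real n \<le> real (c n l) / real n" if "0 < n" for n
      proof -
        have "(real n * t l - 1) / real n \<le> real (c n l) / real n"
          unfolding c_real by (rule divide_right_mono) linarith+
        then show ?thesis using that by (simp add: field_simps)
      qed
      then show "\<forall>\<^sub>F n in sequentially. t l - 1 / real n \<le> real (c n l) / real n"
        by (auto intro!: eventually_sequentiallyI[of 1])
      have "real (c n l) / real n \<le> t l" if "0 < n" for n
        unfolding c_real using that by (simp add: field_simps mult.commute[of "t l"])
      then show "\<forall>\<^sub>F n in sequentially. real (c n l) / real n \<le> t l"
        by (auto intro!: eventually_sequentiallyI[of 1])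
      show "(\<lambda>n. t l - 1 / real n) \<longlonglongrightarrow> t l"
        using tendsto_diff[OF tendsto_const lim_1_over_n, of "t l"] by simp
    qed simp
    have c_range: "real (c n l) / real n \<in> {0..1}" if "l \<le> k" for n l
    proof -
      have "\<lfloor>real n * t l\<rfloor> \<le> \<lfloor>real n * 1\<rfloor>" using t_range[OF that] by (intro floor_mono mult_left_mono) auto
      then have "c n l \<le> n" by (simp add: c_def)
      then show ?thesis by (auto simp: divide_le_eq_1)
    qed
    have "(\<lambda>n. w l (real (c n l') / real n)) \<longlonglongrightarrow> w l (t l')" if "l \<in> {1..k}" "l' \<le> k" for l l'
      by (rule continuous_on_tendsto_compose[OF w[OF that(1)] ct[OF that(2)] t_range[OF that(2)]])
        (simp add: c_range[OF that(2)] del: atLeastAtMost_iff)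
    then show ?thesis unfolding lower_def t(2)
      by (intro tendsto_sum tendsto_diff) auto
  qed
  have "(\<lambda>n. path_max n k (g n)) \<longlonglongrightarrow> max_increments k w"
  proof (rule tendsto_sandwich[OF _ _ lim tendsto_const])
    show "\<forall>\<^sub>F n in sequentially. lower n \<le> path_max n k (g n)" by (intro always_eventually allI ge)
    show "\<forall>\<^sub>F n in sequentially. path_max n k (g n) \<le> max_increments k w"
      using le by (rule eventually_sequentiallyI)
  qed
  then show ?thesis by (simp add: g_def)
qed

text \<open>
  A contribution \<open>d i\<close> that is the same for all letters is collected by every path.
\<close>

lemma path_max_affine:
  assumes k: "1 \<le> k" and a: "0 \<le> a"
  shows "path_max n k (\<lambda>i l. a * (x i l + d i)) = a * (path_max n k x + (\<Sum>i=1..n. d i))"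
proof (rule antisym)
  have eq: "path_sum n (\<lambda>i l. a * (x i l + d i)) \<pi> = a * (path_sum n x \<pi> + (\<Sum>i=1..n. d i))" for \<pi>
    by (simp only: path_sum_def sum_distrib_left sum.distrib distrib_left)
  obtain \<pi> where "\<pi> \<in> increasing_paths n k" "path_max n k (\<lambda>i l. a * (x i l + d i)) = path_sum n (\<lambda>i l. a * (x i l + d i)) \<pi>"
    using path_max_attained[OF k] by blast
  then show "path_max n k (\<lambda>i l. a * (x i l + d i)) \<le> a * (path_max n k x + (\<Sum>i=1..n. d i))"
    using a path_sum_le_path_max[of \<pi> n k x] by (simp add: eq mult_left_mono)
  obtain \<pi> where "\<pi> \<in> increasing_paths n k" "path_max n k x = path_sum n x \<pi>"
    using path_max_attained[OF k] by blast
  then show "a * (path_max n k x + (\<Sum>i=1..n. d i)) \<le> path_max n k (\<lambda>i l. a * (x i l + d i))"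
    using path_sum_le_path_max[of \<pi> n k "\<lambda>i l. a * (x i l + d i)"] by (simp add: eq)
qed

section \<open>Gaussian steps\<close>

text \<open>
  Independence of the rows together with independence inside each row gives joint independence of all
  entries. It suffices to compare probabilities of boxes.
\<close>

lemma (in prob_space) indep_vars_nested:
  assumes "finite I" "I \<noteq> {}" "finite L" "L \<noteq> {}"
    and outer: "indep_vars (\<lambda>_. PiM I (\<lambda>_. borel)) (\<lambda>l \<omega>. \<lambda>i\<in>I. g i l \<omega>) L"
    and inner: "\<And>l. l \<in> L \<Longrightarrow> indep_vars (\<lambda>_. borel :: real measure) (\<lambda>i. g i l) I"
  shows "indep_vars (\<lambda>_. borel) (\<lambda>(i, l). g i l) (I \<times> L)"
proof -
  have rv: "g i l \<in> borel_measurable M" if "i \<in> I" "l \<in> L" for i l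
    using inner[OF that(2)] that(1) by (auto simp: indep_vars_def)
  show ?thesis
  proof (rule iffD2[OF indep_vars_finite[where E = "\<lambda>_. sets borel"]])
    show "I \<times> L \<noteq> {}" "finite (I \<times> L)" using assms(1-4) by auto
    show "sets borel = sigma_sets (space borel) (sets (borel :: real measure))" by (rule sets.sigma_sets_eq[symmetric])
    show "Int_stable (sets (borel :: real measure))" by (rule sets.Int_stable)
    show "space borel \<in> sets (borel :: real measure)" by (rule sets.top)
    show "sets borel \<subseteq> Pow (space (borel :: real measure))" by (rule sets.space_closed)
    show "random_variable borel (case j of (i, l) \<Rightarrow> g i l)" if "j \<in> I \<times> L" for j
      using rv that by auto
    show "\<forall>A\<in>I \<times> L \<rightarrow> sets borel. prob (\<Inter>j\<in>I \<times> L. (case j of (i, l) \<Rightarrow> g i l) -` A j \<inter> space M)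
        = (\<Prod>j\<in>I \<times> L. prob ((case j of (i, l) \<Rightarrow> g i l) -` A j \<inter> space M))"
    proof
      fix A assume A: "A \<in> I \<times> L \<rightarrow> sets (borel :: real measure)"
      define E where "E l = (\<Pi>\<^sub>E i\<in>I. A (i, l))" for l
      have E: "E l \<in> sets (PiM I (\<lambda>_. borel))" if "l \<in> L" for l
        unfolding E_def using A that assms(1) by (intro sets_PiM_I_finite) auto
      have vec: "(\<lambda>\<omega>. \<lambda>i\<in>I. g i l \<omega>) -` E l \<inter> space M = (\<Inter>i\<in>I. g i l -` A (i, l) \<inter> space M)" for l
        using assms(2) by (auto simp: E_def PiE_iff)
      have "prob (\<Inter>j\<in>I \<times> L. (case j of (i, l) \<Rightarrow> g i l) -` A j \<inter> space M)
          = prob (\<Inter>l\<in>L. (\<lambda>\<omega>. \<lambda>i\<in>I. g i l \<omega>) -` E l \<inter> space M)"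
        unfolding vec by (rule arg_cong[of _ _ prob]) (use assms(2,4) in auto)
      also have "\<dots> = (\<Prod>l\<in>L. prob ((\<lambda>\<omega>. \<lambda>i\<in>I. g i l \<omega>) -` E l \<inter> space M))"
        by (rule indep_varsD_finite[OF outer assms(4,3) E])
      also have "\<dots> = (\<Prod>l\<in>L. \<Prod>i\<in>I. prob (g i l -` A (i, l) \<inter> space M))"
        unfolding vec using A by (intro prod.cong refl indep_varsD_finite[OF inner assms(2,1)]) auto
      also have "\<dots> = (\<Prod>i\<in>I. \<Prod>l\<in>L. prob (g i l -` A (i, l) \<inter> space M))"
        by (rule prod.swap)
      also have "\<dots> = (\<Prod>j\<in>I \<times> L. prob ((case j of (i, l) \<Rightarrow> g i l) -` A j \<inter> space M))"
        by (subst prod.cartesian_product) (auto intro!: prod.cong)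
      finally show "prob (\<Inter>j\<in>I \<times> L. (case j of (i, l) \<Rightarrow> g i l) -` A j \<inter> space M)
        = (\<Prod>j\<in>I \<times> L. prob ((case j of (i, l) \<Rightarrow> g i l) -` A j \<inter> space M))" .
    qed
  qed
qed

lemma (in prob_space) step_law_linear_image:
  fixes g :: "nat \<Rightarrow> 'a \<Rightarrow> real" and a :: "nat \<Rightarrow> nat \<Rightarrow> real"
  assumes k: "1 \<le> k" and rv: "\<And>j. j \<in> {1..k} \<Longrightarrow> g j \<in> borel_measurable M"
    and I1: "\<And>j. j \<in> {1..k} \<Longrightarrow> integrable M (g j)"
    and E1: "\<And>j. j \<in> {1..k} \<Longrightarrow> expectation (g j) = 0"
    and I2: "\<And>j j'. j \<in> {1..k} \<Longrightarrow> j' \<in> {1..k} \<Longrightarrow> integrable M (\<lambda>\<omega>. g j \<omega> * g j' \<omega>)"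
    and E2: "\<And>j j'. j \<in> {1..k} \<Longrightarrow> j' \<in> {1..k} \<Longrightarrow> expectation (\<lambda>\<omega>. g j \<omega> * g j' \<omega>) = (if j = j' then v else 0)"
    and I3: "\<And>j. j \<in> {1..k} \<Longrightarrow> integrable M (\<lambda>\<omega>. \<bar>g j \<omega>\<bar> ^ 3)"
    and E3: "\<And>j. j \<in> {1..k} \<Longrightarrow> expectation (\<lambda>\<omega>. \<bar>g j \<omega>\<bar> ^ 3) \<le> s"
    and K: "\<And>l j. \<bar>a l j\<bar> \<le> K"
  shows "step_law k (\<lambda>l l'. v * (\<Sum>j=1..k. a l j * a l' j)) (K ^ 3 * real k ^ 3 * (real k * s))
    (distr M (PiM {1..k} (\<lambda>_. borel)) (\<lambda>\<omega>. \<lambda>l\<in>{1..k}. \<Sum>j=1..k. a l j * g j \<omega>))"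
proof -
  let ?R = "PiM {1..k} (\<lambda>_. borel) :: (nat \<Rightarrow> real) measure"
  define Z where "Z l \<omega> = (\<Sum>j=1..k. a l j * g j \<omega>)" for l \<omega>
  have Zm: "Z l \<in> borel_measurable M" for l
    unfolding Z_def by (intro borel_measurable_sum borel_measurable_times borel_measurable_const rv)
  have vm: "(\<lambda>\<omega>. \<lambda>l\<in>{1..k}. Z l \<omega>) \<in> measurable M ?R"
    by (intro measurable_restrict Zm)
  have coord [measurable]: "(\<lambda>y. y l) \<in> borel_measurable ?R" if "l \<in> {1..k}" for l
    by (rule measurable_component_singleton[OF that])
  have K0: "0 \<le> K" using K[of 0 0] abs_ge_zero[of "a 0 0"] by linarith
  have bound: "\<bar>Z l \<omega>\<bar> ^ 3 \<le> K ^ 3 * real k ^ 3 * (\<Sum>j=1..k. \<bar>g j \<omega>\<bar> ^ 3)" for l \<omega>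
  proof -
    define R where "R = Max ((\<lambda>j. \<bar>g j \<omega>\<bar>) ` {1..k})"
    have R_ge: "\<bar>g j \<omega>\<bar> \<le> R" if "j \<in> {1..k}" for j
      unfolding R_def by (rule Max_ge) (use that in auto)
    have "R \<in> (\<lambda>j. \<bar>g j \<omega>\<bar>) ` {1..k}" unfolding R_def by (rule Max_in) (use k in auto)
    then obtain j where j: "j \<in> {1..k}" "R = \<bar>g j \<omega>\<bar>" by blast
    have "\<bar>Z l \<omega>\<bar> \<le> (\<Sum>j=1..k. \<bar>a l j * g j \<omega>\<bar>)" unfolding Z_def by (rule sum_abs)
    also have "\<dots> \<le> (\<Sum>j=1..k. K * R)"
      unfolding abs_mult by (intro sum_mono mult_mono K R_ge K0) auto
    finally have "\<bar>Z l \<omega>\<bar> \<le> K * real k * R" by (simp add: ac_simps)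
    then have "\<bar>Z l \<omega>\<bar> ^ 3 \<le> (K * real k * R) ^ 3" by (intro power_mono) auto
    also have "\<dots> = K ^ 3 * real k ^ 3 * \<bar>g j \<omega>\<bar> ^ 3" by (simp add: power_mult_distrib j)
    also have "\<dots> \<le> K ^ 3 * real k ^ 3 * (\<Sum>j=1..k. \<bar>g j \<omega>\<bar> ^ 3)"
      using K0 by (intro mult_left_mono member_le_sum[OF j(1)]) auto
    finally show ?thesis .
  qed
  have Ib: "integrable M (\<lambda>\<omega>. K ^ 3 * real k ^ 3 * (\<Sum>j=1..k. \<bar>g j \<omega>\<bar> ^ 3))"
    using I3 by (intro integrable_mult_right integrable_sum) auto
  have IZ: "integrable M (\<lambda>\<omega>. \<bar>Z l \<omega>\<bar> ^ 3)" for l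
    by (rule Bochner_Integration.integrable_bound[OF Ib]) (use Zm[of l] bound[of l] in \<open>auto simp: sum_nonneg K0 intro: order_trans[OF _ abs_ge_self]\<close>)
  have "expectation (\<lambda>\<omega>. \<bar>Z l \<omega>\<bar> ^ 3) \<le> expectation (\<lambda>\<omega>. K ^ 3 * real k ^ 3 * (\<Sum>j=1..k. \<bar>g j \<omega>\<bar> ^ 3))" for l
    by (rule integral_mono[OF IZ Ib bound])
  also have "\<dots> = K ^ 3 * real k ^ 3 * (\<Sum>j=1..k. expectation (\<lambda>\<omega>. \<bar>g j \<omega>\<bar> ^ 3))"
    using I3 by simp
  also have "\<dots> \<le> K ^ 3 * real k ^ 3 * (\<Sum>j=1..k. s)"
    using K0 by (intro mult_left_mono sum_mono E3) auto
  finally have EZ: "expectation (\<lambda>\<omega>. \<bar>Z l \<omega>\<bar> ^ 3) \<le> K ^ 3 * real k ^ 3 * (real k * s)" for l by simp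
  have EZ1: "expectation (Z l) = 0" for l
    unfolding Z_def using I1 E1 by simp
  have EZ2: "expectation (\<lambda>\<omega>. Z l \<omega> * Z l' \<omega>) = v * (\<Sum>j=1..k. a l j * a l' j)" for l l'
  proof -
    have "Z l \<omega> * Z l' \<omega> = (\<Sum>j=1..k. \<Sum>j'=1..k. (a l j * a l' j') * (g j \<omega> * g j' \<omega>))" for \<omega>
      unfolding Z_def sum_product by (intro sum.cong refl) (simp add: ac_simps)
    moreover have "has_bochner_integral M (\<lambda>\<omega>. \<Sum>j=1..k. \<Sum>j'=1..k. (a l j * a l' j') * (g j \<omega> * g j' \<omega>))
        (\<Sum>j=1..k. \<Sum>j'=1..k. (a l j * a l' j') * (if j = j' then v else 0))"
      by (intro has_bochner_integral_sum has_bochner_integral_mult_right)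
        (simp add: has_bochner_integral_iff I2 E2)
    ultimately have "expectation (\<lambda>\<omega>. Z l \<omega> * Z l' \<omega>)
        = (\<Sum>j=1..k. \<Sum>j'=1..k. (a l j * a l' j') * (if j = j' then v else 0))"
      by (simp only: has_bochner_integral_integral_eq)
    also have "\<dots> = (\<Sum>j=1..k. \<Sum>j'=1..k. if j = j' then (a l j * a l' j') * v else 0)"
      by (intro sum.cong refl) simp
    also have "\<dots> = v * (\<Sum>j=1..k. a l j * a l' j)"
      by (simp add: sum.delta' sum_distrib_left ac_simps)
    finally show ?thesis .
  qed
  have "step_law k (\<lambda>l l'. v * (\<Sum>j=1..k. a l j * a l' j)) (K ^ 3 * real k ^ 3 * (real k * s)) (distr M ?R (\<lambda>\<omega>. \<lambda>l\<in>{1..k}. Z l \<omega>))"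
    unfolding step_law_def
  proof (intro conjI ballI)
    show "prob_space (distr M ?R (\<lambda>\<omega>. \<lambda>l\<in>{1..k}. Z l \<omega>))" by (rule prob_space_distr[OF vm])
    show "sets (distr M ?R (\<lambda>\<omega>. \<lambda>l\<in>{1..k}. Z l \<omega>)) = sets ?R" by simp
    fix l assume l: "l \<in> {1..k}"
    have m3: "(\<lambda>y. \<bar>y l\<bar> ^ 3) \<in> borel_measurable ?R" using l by measurable
    show "integrable (distr M ?R (\<lambda>\<omega>. \<lambda>l\<in>{1..k}. Z l \<omega>)) (\<lambda>y. \<bar>y l\<bar> ^ 3)"
      unfolding integrable_distr_eq[OF vm m3] using IZ[of l] l by simp
    show "(\<integral>y. \<bar>y l\<bar> ^ 3 \<partial>distr M ?R (\<lambda>\<omega>. \<lambda>l\<in>{1..k}. Z l \<omega>)) \<le> K ^ 3 * real k ^ 3 * (real k * s)"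
      unfolding integral_distr[OF vm m3] using EZ[of l] l by simp
    show "(\<integral>y. y l \<partial>distr M ?R (\<lambda>\<omega>. \<lambda>l\<in>{1..k}. Z l \<omega>)) = 0"
      unfolding integral_distr[OF vm coord[OF l]] using EZ1[of l] l by simp
    fix l' assume l': "l' \<in> {1..k}"
    have m2: "(\<lambda>y. y l * y l') \<in> borel_measurable ?R" using l l' by measurable
    show "(\<integral>y. y l * y l' \<partial>distr M ?R (\<lambda>\<omega>. \<lambda>l\<in>{1..k}. Z l \<omega>)) = v * (\<Sum>j=1..k. a l j * a l' j)"
      unfolding integral_distr[OF vm m2] using EZ2[of l l'] l l' by simp
  qed
  then show ?thesis unfolding Z_def .
qed

lemma normal_distributed_moments:
  assumes "prob_space M" and X: "distributed M lborel X (normal_density 0 \<sigma>)" and \<sigma>: "0 < \<sigma>"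
  shows "integrable M X" "(\<integral>\<omega>. X \<omega> \<partial>M) = 0"
    and "integrable M (\<lambda>\<omega>. X \<omega> * X \<omega>)" "(\<integral>\<omega>. X \<omega> * X \<omega> \<partial>M) = \<sigma>\<^sup>2"
    and "integrable M (\<lambda>\<omega>. \<bar>X \<omega>\<bar> ^ 3)" "(\<integral>\<omega>. \<bar>X \<omega>\<bar> ^ 3 \<partial>M) \<le> 2 * \<sigma> ^ 3"
proof -
  interpret prob_space M by fact
  have nn: "0 \<le> normal_density 0 \<sigma> x" for x by simp
  have I: "integrable M (\<lambda>\<omega>. f (X \<omega>)) \<and> (\<integral>\<omega>. f (X \<omega>) \<partial>M) = c"
    if f: "f \<in> borel_measurable borel" and h: "has_bochner_integral lborel (\<lambda>x. normal_density 0 \<sigma> x * f x) c" for f :: "real \<Rightarrow> real" and c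
    using distributed_integrable[OF X, of f] distributed_integral[OF X, of f] h f nn
    by (simp add: has_bochner_integral_iff)
  show "integrable M X" "(\<integral>\<omega>. X \<omega> \<partial>M) = 0"
    using I[of "\<lambda>x. x" 0] normal_moment_odd[OF \<sigma>, of 0 0] by simp_all
  show "integrable M (\<lambda>\<omega>. X \<omega> * X \<omega>)" "(\<integral>\<omega>. X \<omega> * X \<omega> \<partial>M) = \<sigma>\<^sup>2"
    using I[of "\<lambda>x. x * x" "\<sigma>\<^sup>2"] normal_moment_even[OF \<sigma>, of 0 1] by (simp_all add: power2_eq_square fact_numeral)
  have "integrable M (\<lambda>\<omega>. \<bar>X \<omega>\<bar> ^ 3) \<and> (\<integral>\<omega>. \<bar>X \<omega>\<bar> ^ 3 \<partial>M) = 2 * \<sigma> ^ 3 * sqrt (2 / pi)"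
    using I[of "\<lambda>x. \<bar>x\<bar> ^ 3" "2 * \<sigma> ^ 3 * sqrt (2 / pi)"] normal_moment_abs_odd[OF \<sigma>, of 0 1] by simp
  moreover have "2 * \<sigma> ^ 3 * sqrt (2 / pi) \<le> 2 * \<sigma> ^ 3 * 1"
    using \<sigma> pi_ge_two by (intro mult_left_mono) auto
  ultimately show "integrable M (\<lambda>\<omega>. \<bar>X \<omega>\<bar> ^ 3)" "(\<integral>\<omega>. \<bar>X \<omega>\<bar> ^ 3 \<partial>M) \<le> 2 * \<sigma> ^ 3" by auto
qed

text \<open>
  The components are independent as processes and each has independent increments, so the increments
  over the grid are jointly independent in time and component.
\<close>

lemma brownian_increments_indep:
  assumes "prob_space N" and B: "standard_brownian_motion_dim k N B" and k: "1 \<le> k" and n: "1 \<le> n"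
  shows "prob_space.indep_vars N (\<lambda>_. borel) (\<lambda>(i, l) \<omega>. B l (real i / real n) \<omega> - B l (real (i - 1) / real n) \<omega>) ({1..n} \<times> {1..k})"
proof -
  interpret prob_space N by fact
  define g where "g i l \<omega> = B l (real i / real n) \<omega> - B l (real (i - 1) / real n) \<omega>" for i l \<omega>
  have BM: "standard_brownian_motion N (B l)" if "l \<in> {1..k}" for l
    using B that by (simp add: standard_brownian_motion_dim_def)
  have inner: "indep_vars (\<lambda>_. borel) (\<lambda>i. g i l) {1..n}" if "l \<in> {1..k}" for l
  proof -
    have "mono_on {0..n} (\<lambda>i. real i / real n) \<and> (\<lambda>i. real i / real n) ` {0..n} \<subseteq> {0..1}"
      using n by (auto simp: mono_on_def divide_right_mono divide_le_eq_1)
    then have "indep_vars (\<lambda>_. borel) (\<lambda>i \<omega>. B l (real i / real n) \<omega> - B l (real (i - 1) / real n) \<omega>) {1..n}"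
      using BM[OF that] unfolding standard_brownian_motion_def by blast
    then show ?thesis by (simp add: g_def[abs_def])
  qed
  have grid: "real i / real n \<in> {0..1}" "real (i - 1) / real n \<in> {0..1}" if "i \<in> {1..n}" for i
    using that by (auto simp: divide_le_eq_1)
  have "indep_vars (\<lambda>_. PiM {1..n} (\<lambda>_. borel))
      (\<lambda>l \<omega>. \<lambda>i\<in>{1..n}. restrict (\<lambda>t. B l t \<omega>) {0..1} (real i / real n) - restrict (\<lambda>t. B l t \<omega>) {0..1} (real (i - 1) / real n)) {1..k}"
  proof (rule indep_vars_compose2[where Y = "\<lambda>l w. \<lambda>i\<in>{1..n}. w (real i / real n) - w (real (i - 1) / real n)"])
    show "indep_vars (\<lambda>_. PiM {0..1} (\<lambda>_. borel)) (\<lambda>l \<omega>. restrict (\<lambda>t. B l t \<omega>) {0..1}) {1..k}"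
      using B by (simp add: standard_brownian_motion_dim_def)
    show "(\<lambda>w. \<lambda>i\<in>{1..n}. w (real i / real n) - w (real (i - 1) / real n))
        \<in> measurable (PiM {0..1} (\<lambda>_. borel)) (PiM {1..n} (\<lambda>_. borel :: real measure))"
      by (intro measurable_restrict borel_measurable_diff measurable_component_singleton grid)
  qed
  also have "(\<lambda>l \<omega>. \<lambda>i\<in>{1..n}. restrict (\<lambda>t. B l t \<omega>) {0..1} (real i / real n) - restrict (\<lambda>t. B l t \<omega>) {0..1} (real (i - 1) / real n))
      = (\<lambda>l \<omega>. \<lambda>i\<in>{1..n}. g i l \<omega>)"
    using grid by (intro ext restrict_ext) (simp add: g_def del: atLeastAtMost_iff)
  finally have outer: "indep_vars (\<lambda>_. PiM {1..n} (\<lambda>_. borel)) (\<lambda>l \<omega>. \<lambda>i\<in>{1..n}. g i l \<omega>) {1..k}" .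
  have "indep_vars (\<lambda>_. borel) (\<lambda>(i, l). g i l) ({1..n} \<times> {1..k})"
    by (rule indep_vars_nested[OF _ _ _ _ outer inner]) (use k n in auto)
  then show ?thesis by (simp add: g_def[abs_def])
qed

lemma path_max_cong:
  assumes "\<And>i l. i \<in> {1..n} \<Longrightarrow> l \<in> {1..k} \<Longrightarrow> x i l = y i l"
  shows "path_max n k x = path_max n k y"
proof -
  have "path_sum n x \<pi> = path_sum n y \<pi>" if "\<pi> \<in> increasing_paths n k" for \<pi>
    unfolding path_sum_def using increasing_paths_range[OF that] by (intro sum.cong refl assms)
  then show ?thesis unfolding path_max_def by (simp cong: image_cong)
qed

lemma step_law_mono:
  assumes "step_law k C \<rho> P" "\<rho> \<le> \<rho>'" "\<And>l l'. l \<in> {1..k} \<Longrightarrow> l' \<in> {1..k} \<Longrightarrow> C l l' = C' l l'"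
  shows "step_law k C' \<rho>' P"
  using assms by (fastforce simp: step_law_def)

text \<open>
  Linear images \<open>a \<cdot> \<Delta>B\<close> of the increments at different times depend on disjoint blocks of
  the jointly independent family, and the increments at one time are uncorrelated with variance
  \<open>1 / n\<close>.
\<close>

lemma brownian_step_vectors:
  fixes a :: "nat \<Rightarrow> nat \<Rightarrow> real"
  assumes "prob_space N" and B: "standard_brownian_motion_dim k N B" and k: "1 \<le> k" and n: "1 \<le> n"
    and K: "\<And>l j. \<bar>a l j\<bar> \<le> K"
  defines "g \<equiv> \<lambda>i l \<omega>. B l (real i / real n) \<omega> - B l (real (i - 1) / real n) \<omega>"
  defines "Z \<equiv> \<lambda>i \<omega>. \<lambda>l\<in>{1..k}. \<Sum>j=1..k. a l j * g i j \<omega>"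
  shows "prob_space.indep_vars N (\<lambda>_. PiM {1..k} (\<lambda>_. borel)) Z {1..n}"
    and "\<And>i. i \<in> {1..n} \<Longrightarrow> step_law k (\<lambda>l l'. (1 / real n) * (\<Sum>j=1..k. a l j * a l' j))
      (K ^ 3 * real k ^ 3 * (real k * (2 * (1 / sqrt (real n)) ^ 3))) (distr N (PiM {1..k} (\<lambda>_. borel)) (Z i))"
proof -
  interpret prob_space N by fact
  have indep: "indep_vars (\<lambda>_. borel) (\<lambda>(i, l) \<omega>. g i l \<omega>) ({1..n} \<times> {1..k})"
    unfolding g_def by (rule brownian_increments_indep[OF assms(1) B k n])
  have "indep_vars (\<lambda>i. PiM ({i} \<times> {1..k}) (\<lambda>_. borel)) (\<lambda>i \<omega>. \<lambda>p\<in>{i} \<times> {1..k}. (case p of (i, l) \<Rightarrow> \<lambda>\<omega>. g i l \<omega>) \<omega>) {1..n}"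
    by (rule indep_vars_restrict[OF indep]) (auto simp: disjoint_family_on_def)
  then have "indep_vars (\<lambda>_. PiM {1..k} (\<lambda>_. borel))
     (\<lambda>i \<omega>. (\<lambda>v. \<lambda>l\<in>{1..k}. \<Sum>j=1..k. a l j * v (i, j)) (\<lambda>p\<in>{i} \<times> {1..k}. (case p of (i, l) \<Rightarrow> \<lambda>\<omega>. g i l \<omega>) \<omega>)) {1..n}"
  proof (rule indep_vars_compose2)
    fix i
    show "(\<lambda>v. \<lambda>l\<in>{1..k}. \<Sum>j=1..k. a l j * v (i, j)) \<in> measurable (PiM ({i} \<times> {1..k}) (\<lambda>_. borel)) (PiM {1..k} (\<lambda>_. borel))"
      by (intro measurable_restrict borel_measurable_sum borel_measurable_times borel_measurable_const measurable_component_singleton) auto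
  qed
  also have "(\<lambda>i \<omega>. (\<lambda>v. \<lambda>l\<in>{1..k}. \<Sum>j=1..k. a l j * v (i, j)) (\<lambda>p\<in>{i} \<times> {1..k}. (case p of (i, l) \<Rightarrow> \<lambda>\<omega>. g i l \<omega>) \<omega>)) = Z"
    unfolding Z_def by (intro ext restrict_ext sum.cong) auto
  finally show "indep_vars (\<lambda>_. PiM {1..k} (\<lambda>_. borel)) Z {1..n}" .
  fix i assume i: "i \<in> {1..n}"
  have rv: "g i l \<in> borel_measurable N" if "l \<in> {1..k}" for l
    using indep i that unfolding indep_vars_def by (auto simp del: atLeastAtMost_iff dest!: bspec[of _ _ "(i, l)"])
  have dist: "distributed N lborel (g i l) (normal_density 0 (1 / sqrt (real n)))" if "l \<in> {1..k}" for l
  proof -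
    have "standard_brownian_motion N (B l)" using B that by (simp add: standard_brownian_motion_dim_def)
    moreover have "0 \<le> real (i - 1) / real n" "real (i - 1) / real n < real i / real n" "real i / real n \<le> 1"
      using i by (auto simp: divide_strict_right_mono divide_le_eq_1)
    ultimately have "distributed N lborel (g i l) (normal_density 0 (sqrt (real i / real n - real (i - 1) / real n)))"
      unfolding standard_brownian_motion_def g_def by blast
    moreover have "real i / real n - real (i - 1) / real n = 1 / real n"
      using i by (simp add: diff_divide_distrib[symmetric] of_nat_diff)
    ultimately show ?thesis by (simp add: real_sqrt_divide)
  qed
  have \<sigma>: "0 < 1 / sqrt (real n)" using n by simp
  note mom = normal_distributed_moments[OF assms(1) dist \<sigma>]
  have cross: "integrable N (\<lambda>\<omega>. g i l \<omega> * g i l' \<omega>) \<and> expectation (\<lambda>\<omega>. g i l \<omega> * g i l' \<omega>) = 0"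
    if l: "l \<in> {1..k}" "l' \<in> {1..k}" "l \<noteq> l'" for l l'
  proof -
    have ind: "indep_vars (\<lambda>_. borel) (\<lambda>(i, l) \<omega>. g i l \<omega>) {(i, l), (i, l')}"
      by (rule indep_vars_subset[OF indep]) (use i l in auto)
    have int: "\<And>p. p \<in> {(i, l), (i, l')} \<Longrightarrow> integrable N (case p of (i, l) \<Rightarrow> \<lambda>\<omega>. g i l \<omega>)"
      using mom(1) l by auto
    have prod: "(\<Prod>p\<in>{(i, l), (i, l')}. f p) = f (i, l) * f (i, l')" for f :: "nat \<times> nat \<Rightarrow> real"
      using l by simp
    show ?thesis
      using indep_vars_lebesgue_integral[OF _ ind int] indep_vars_integrable[OF _ ind int] mom(2) l
      unfolding prod by simp
  qed
  show "step_law k (\<lambda>l l'. (1 / real n) * (\<Sum>j=1..k. a l j * a l' j))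
      (K ^ 3 * real k ^ 3 * (real k * (2 * (1 / sqrt (real n)) ^ 3))) (distr N (PiM {1..k} (\<lambda>_. borel)) (Z i))"
    unfolding Z_def
  proof (rule step_law_linear_image[OF k rv mom(1,2) _ _ mom(5,6) K])
    fix l l' assume l: "l \<in> {1..k}" "l' \<in> {1..k}"
    show "integrable N (\<lambda>\<omega>. g i l \<omega> * g i l' \<omega>)" using cross[OF l] mom(3)[OF l(1)] by (cases "l = l'") auto
    show "expectation (\<lambda>\<omega>. g i l \<omega> * g i l' \<omega>) = (if l = l' then 1 / real n else 0)"
      using cross[OF l] mom(4)[OF l(1)] n by (auto simp: power_divide)
  qed
qed

section \<open>The letters and the loss from rare letters\<close>

locale iid_letters = prob_space M for M :: "'a measure" +
  fixes X :: "nat \<Rightarrow> 'a \<Rightarrow> 'c::linorder" and \<alpha> :: "nat \<Rightarrow> 'c" and p :: "nat \<Rightarrow> real" and m :: nat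
  assumes \<alpha>: "strict_mono_on {1..m} \<alpha>"
    and indep: "indep_vars (\<lambda>_. count_space (\<alpha> ` {1..m})) X {1..}"
    and law: "\<And>i r. 1 \<le> i \<Longrightarrow> r \<in> {1..m} \<Longrightarrow> prob {\<omega> \<in> space M. X i \<omega> = \<alpha> r} = p r"
begin

definition occurs :: "nat \<Rightarrow> nat \<Rightarrow> 'a \<Rightarrow> real" where
  "occurs i r \<omega> = of_bool (X i \<omega> = \<alpha> r)"

lemma letter_measurable: "1 \<le> i \<Longrightarrow> X i \<in> measurable M (count_space (\<alpha> ` {1..m}))"
  using indep by (auto simp: indep_vars_def)

lemma letter_in_alphabet: "1 \<le> i \<Longrightarrow> \<omega> \<in> space M \<Longrightarrow> X i \<omega> \<in> \<alpha> ` {1..m}"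
  using measurable_space[OF letter_measurable] by simp

lemma occurs_measurable [measurable]:
  assumes "1 \<le> i" shows "occurs i r \<in> borel_measurable M"
proof -
  have "(\<lambda>x. of_bool (x = \<alpha> r) :: real) \<in> borel_measurable (count_space (\<alpha> ` {1..m}))" by simp
  from measurable_compose[OF letter_measurable[OF assms] this] show ?thesis
    by (simp add: occurs_def[abs_def])
qed

lemma occurs_expectation:
  assumes "1 \<le> i" "r \<in> {1..m}"
  shows "integrable M (occurs i r)" "expectation (occurs i r) = p r"
proof -
  show "integrable M (occurs i r)"
    using occurs_measurable[OF assms(1)] by (intro integrable_const_bound[of _ 1]) (auto simp: occurs_def)
  have "expectation (occurs i r) = expectation (indicator {\<omega> \<in> space M. X i \<omega> = \<alpha> r})"
    by (intro Bochner_Integration.integral_cong) (auto simp: occurs_def indicator_def)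
  also have "\<dots> = measure M ({\<omega> \<in> space M. X i \<omega> = \<alpha> r} \<inter> space M)" by simp
  also have "{\<omega> \<in> space M. X i \<omega> = \<alpha> r} \<inter> space M = {\<omega> \<in> space M. X i \<omega> = \<alpha> r}" by auto
  finally show "expectation (occurs i r) = p r" using law[OF assms] by simp
qed

lemma occurs_mult:
  assumes "r \<in> {1..m}" "s \<in> {1..m}"
  shows "occurs i r \<omega> * occurs i s \<omega> = (if r = s then occurs i r \<omega> else 0)"
proof -
  have "\<alpha> r = \<alpha> s \<longleftrightarrow> r = s"
    using inj_on_eq_iff[OF strict_mono_on_imp_inj_on[OF \<alpha>] assms] .
  then show ?thesis by (auto simp: occurs_def)
qed

text \<open>
  Since at most one letter occurs at a time, indicators of distinct letters have product zero, which
  gives the covariance \<open>q (I - q J) / n\<close>.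
\<close>

lemma letter_step_vectors:
  assumes j: "strict_mono_on {1..k} j" "j ` {1..k} \<subseteq> {1..m}" and q: "\<And>l. l \<in> {1..k} \<Longrightarrow> p (j l) = q"
    and q01: "0 \<le> q" "q \<le> 1" and n: "1 \<le> n"
  defines "Y \<equiv> \<lambda>i \<omega>. \<lambda>l\<in>{1..k}. (occurs i (j l) \<omega> - q) / sqrt (real n)"
  shows "indep_vars (\<lambda>_. PiM {1..k} (\<lambda>_. borel)) Y {1..n}"
    and "\<And>i. i \<in> {1..n} \<Longrightarrow> step_law k (\<lambda>l l'. ((if l = l' then q else 0) - q\<^sup>2) / real n) ((1 / sqrt (real n)) ^ 3)
           (distr M (PiM {1..k} (\<lambda>_. borel)) (Y i))"
proof -
  let ?R = "PiM {1..k} (\<lambda>_. borel) :: (nat \<Rightarrow> real) measure"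
  have "indep_vars (\<lambda>_. ?R) (\<lambda>i \<omega>. (\<lambda>x. \<lambda>l\<in>{1..k}. (of_bool (x = \<alpha> (j l)) - q) / sqrt (real n)) (X i \<omega>)) {1..n}"
  proof (rule indep_vars_compose2)
    show "indep_vars (\<lambda>_. count_space (\<alpha> ` {1..m})) X {1..n}" by (rule indep_vars_subset[OF indep]) auto
    show "(\<lambda>x. \<lambda>l\<in>{1..k}. (of_bool (x = \<alpha> (j l)) - q) / sqrt (real n)) \<in> measurable (count_space (\<alpha> ` {1..m})) ?R"
      by (intro measurable_restrict) simp
  qed
  then show "indep_vars (\<lambda>_. ?R) Y {1..n}" by (simp add: Y_def occurs_def)
  fix i assume i: "i \<in> {1..n}"
  have jm: "j l \<in> {1..m}" if "l \<in> {1..k}" for l using j(2) that by blast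
  have i1: "1 \<le> i" using i by simp
  define W where "W l \<omega> = (occurs i (j l) \<omega> - q) / sqrt (real n)" for l \<omega>
  have Wm [measurable]: "W l \<in> borel_measurable M" for l
    unfolding W_def using occurs_measurable[OF i1] by measurable
  have vm: "Y i \<in> measurable M ?R"
    unfolding Y_def W_def[symmetric] by (intro measurable_restrict Wm)
  have YW: "Y i \<omega> l = W l \<omega>" if "l \<in> {1..k}" for l \<omega> using that by (simp add: Y_def W_def)
  have Wb: "\<bar>W l \<omega>\<bar> \<le> 1 / sqrt (real n)" for l \<omega>
  proof -
    have "\<bar>occurs i (j l) \<omega> - q\<bar> \<le> 1" using q01 by (auto simp: occurs_def)
    then show ?thesis by (simp add: W_def divide_right_mono)
  qed
  have W3: "\<bar>W l \<omega>\<bar> ^ 3 \<le> (1 / sqrt (real n)) ^ 3" for l \<omega> by (intro power_mono Wb) auto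
  have I3: "integrable M (\<lambda>\<omega>. \<bar>W l \<omega>\<bar> ^ 3)" for l
    by (rule integrable_const_bound[of _ "(1 / sqrt (real n)) ^ 3"]) (use W3 in auto)
  have "expectation (\<lambda>\<omega>. \<bar>W l \<omega>\<bar> ^ 3) \<le> (1 / sqrt (real n)) ^ 3" for l
    by (rule integral_le_const[OF I3]) (use W3 in auto)
  note E3 = this
  have E1: "expectation (W l) = 0" if l: "l \<in> {1..k}" for l
    unfolding W_def using occurs_expectation[OF i1 jm[OF l]] q[OF l] by (simp add: prob_space)
  have E2: "expectation (\<lambda>\<omega>. W l \<omega> * W l' \<omega>) = ((if l = l' then q else 0) - q\<^sup>2) / real n"
    if l: "l \<in> {1..k}" "l' \<in> {1..k}" for l l'
  proof -
    have jj: "j l = j l' \<longleftrightarrow> l = l'" using inj_on_eq_iff[OF strict_mono_on_imp_inj_on[OF j(1)] l] .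
    have eq: "W l \<omega> * W l' \<omega> = ((if l = l' then occurs i (j l) \<omega> else 0) - q * occurs i (j l) \<omega> - q * occurs i (j l') \<omega> + q\<^sup>2) / real n" for \<omega>
    proof -
      have "W l \<omega> * W l' \<omega> = (occurs i (j l) \<omega> * occurs i (j l') \<omega> - q * occurs i (j l) \<omega> - q * occurs i (j l') \<omega> + q\<^sup>2) / (sqrt (real n) * sqrt (real n))"
        unfolding W_def by (simp add: algebra_simps power2_eq_square add_divide_distrib diff_divide_distrib)
      then show ?thesis unfolding occurs_mult[OF jm[OF l(1)] jm[OF l(2)]] jj by simp
    qed
    have "has_bochner_integral M (\<lambda>\<omega>. ((if l = l' then occurs i (j l) \<omega> else 0) - q * occurs i (j l) \<omega> - q * occurs i (j l') \<omega> + q\<^sup>2) / real n)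
       (((if l = l' then q else 0) - q * q - q * q + q\<^sup>2) / real n)"
    proof (intro has_bochner_integral_divide_zero has_bochner_integral_add has_bochner_integral_diff has_bochner_integral_mult_right)
      show "has_bochner_integral M (\<lambda>\<omega>. if l = l' then occurs i (j l) \<omega> else 0) (if l = l' then q else 0)"
        using occurs_expectation[OF i1 jm[OF l(1)]] q[OF l(1)] by (auto simp: has_bochner_integral_iff)
      show "has_bochner_integral M (\<lambda>\<omega>. q\<^sup>2) (q\<^sup>2)" by (simp add: has_bochner_integral_iff prob_space)
    qed (use occurs_expectation[OF i1 jm] q l in \<open>auto simp: has_bochner_integral_iff\<close>)
    from has_bochner_integral_integral_eq[OF this] show ?thesis
      unfolding eq by (simp add: power2_eq_square)
  qed
  have coord [measurable]: "(\<lambda>y. y l) \<in> borel_measurable ?R" if "l \<in> {1..k}" for l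
    by (rule measurable_component_singleton[OF that])
  show "step_law k (\<lambda>l l'. ((if l = l' then q else 0) - q\<^sup>2) / real n) ((1 / sqrt (real n)) ^ 3) (distr M ?R (Y i))"
    unfolding step_law_def
  proof (intro conjI ballI)
    show "prob_space (distr M ?R (Y i))" by (rule prob_space_distr[OF vm])
    show "sets (distr M ?R (Y i)) = sets ?R" by simp
    fix l assume l: "l \<in> {1..k}"
    have m3: "(\<lambda>y. \<bar>y l\<bar> ^ 3) \<in> borel_measurable ?R" using l by measurable
    show "integrable (distr M ?R (Y i)) (\<lambda>y. \<bar>y l\<bar> ^ 3)"
      unfolding integrable_distr_eq[OF vm m3] YW[OF l] by (rule I3)
    show "(\<integral>y. \<bar>y l\<bar> ^ 3 \<partial>distr M ?R (Y i)) \<le> (1 / sqrt (real n)) ^ 3"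
      unfolding integral_distr[OF vm m3] YW[OF l] by (rule E3)
    show "(\<integral>y. y l \<partial>distr M ?R (Y i)) = 0"
      unfolding integral_distr[OF vm coord[OF l]] YW[OF l] by (rule E1[OF l])
    fix l' assume l': "l' \<in> {1..k}"
    have m2: "(\<lambda>y. y l * y l') \<in> borel_measurable ?R" using l l' by measurable
    show "(\<integral>y. y l * y l' \<partial>distr M ?R (Y i)) = ((if l = l' then q else 0) - q\<^sup>2) / real n"
      unfolding integral_distr[OF vm m2] YW[OF l] YW[OF l'] by (rule E2[OF l l'])
  qed
qed

text \<open>
  Exponential tilting by \<open>\<mu> = ln (p s / p r)\<close> makes each factor
  \<open>exp (\<mu> (occurs i r - occurs i s))\<close> have mean
  \<open>p s + p r + (1 - p r - p s) = 1\<close>. Hence the exponential of the walk has mean 1 over every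
  interval, and Markov's inequality applies.
\<close>

lemma rare_letter_excess_tail:
  assumes r: "r \<in> {1..m}" and s: "s \<in> {1..m}" and pr: "0 < p r" "p r < p s" and \<kappa>: "\<kappa> \<le> ln (p s / p r)" and D: "0 \<le> D"
  shows "prob {\<omega> \<in> space M. D \<le> (\<Sum>i\<in>{a<..b}. occurs i r \<omega> - occurs i s \<omega>)} \<le> exp (- \<kappa> * D)"
proof -
  define \<mu> where "\<mu> = ln (p s / p r)"
  define u where "u i \<omega> = exp (\<mu> * (occurs i r \<omega> - occurs i s \<omega>))" for i \<omega>
  have rs: "r \<noteq> s" using pr by auto
  have \<mu>: "0 < \<mu>" "exp \<mu> = p s / p r" "exp (- \<mu>) = p r / p s"
    using pr by (auto simp: \<mu>_def exp_minus ln_gt_zero_iff[THEN iffD2])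
  have u: "integrable M (u i) \<and> expectation (u i) = 1" if i: "1 \<le> i" for i
  proof -
    have ui: "u i = (\<lambda>\<omega>. 1 + (p s / p r - 1) * occurs i r \<omega> + (p r / p s - 1) * occurs i s \<omega>)"
    proof
      fix \<omega>
      show "u i \<omega> = 1 + (p s / p r - 1) * occurs i r \<omega> + (p r / p s - 1) * occurs i s \<omega>"
        using occurs_mult[OF r s, of i \<omega>] rs \<mu> by (auto simp: u_def occurs_def split: if_splits)
    qed
    have "has_bochner_integral M (u i) (1 + (p s / p r - 1) * p r + (p r / p s - 1) * p s)"
      unfolding ui using occurs_expectation[OF i r] occurs_expectation[OF i s]
      by (simp add: has_bochner_integral_iff prob_space)
    moreover have "1 + (p s / p r - 1) * p r + (p r / p s - 1) * p s = 1" using pr by (simp add: field_simps)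
    ultimately show ?thesis by (simp add: has_bochner_integral_iff)
  qed
  have ind: "indep_vars (\<lambda>_. borel) u {a<..b}"
  proof -
    have "indep_vars (\<lambda>_. borel) (\<lambda>i \<omega>. (\<lambda>x. exp (\<mu> * (of_bool (x = \<alpha> r) - of_bool (x = \<alpha> s)))) (X i \<omega>)) {a<..b}"
      by (rule indep_vars_compose2[OF indep_vars_subset[OF indep]]) auto
    then show ?thesis by (simp add: u_def[abs_def] occurs_def)
  qed
  let ?S = "\<lambda>\<omega>. \<Sum>i\<in>{a<..b}. occurs i r \<omega> - occurs i s \<omega>"
  have exp_sum: "exp (\<mu> * ?S \<omega>) = (\<Prod>i\<in>{a<..b}. u i \<omega>)" for \<omega>
    by (simp add: u_def sum_distrib_left exp_sum)
  have ui: "\<And>i. i \<in> {a<..b} \<Longrightarrow> integrable M (u i)" using u by auto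
  have E: "expectation (\<lambda>\<omega>. exp (\<mu> * ?S \<omega>)) = 1" "integrable M (\<lambda>\<omega>. exp (\<mu> * ?S \<omega>))"
    unfolding exp_sum using indep_vars_lebesgue_integral[OF _ ind ui] indep_vars_integrable[OF _ ind ui] u
    by (auto intro!: prod.neutral)
  have "prob {\<omega> \<in> space M. D \<le> ?S \<omega>} = prob {\<omega> \<in> space M. exp (\<mu> * D) \<le> exp (\<mu> * ?S \<omega>)}"
    using \<mu> by (simp add: mult_le_cancel_left_pos)
  also have "\<dots> \<le> expectation (\<lambda>\<omega>. exp (\<mu> * ?S \<omega>)) / exp (\<mu> * D)"
    by (rule integral_Markov_inequality_measure[where A = "{}"]) (use E in auto)
  also have "\<dots> = exp (- \<mu> * D)" using E by (simp add: exp_minus field_simps)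
  also have "\<dots> \<le> exp (- \<kappa> * D)" using \<kappa> D by (simp add: \<mu>_def mult_right_mono)
  finally show ?thesis .
qed

lemma occurs_interval_measurable [measurable]:
  "(\<lambda>\<omega>. \<Sum>i\<in>{a<..b}. occurs i r \<omega> - occurs i s \<omega>) \<in> borel_measurable M"
  by (intro borel_measurable_sum borel_measurable_diff occurs_measurable) auto

lemma occurs_path_max_measurable:
  "(\<lambda>\<omega>. path_max n k (\<lambda>i l. occurs i (j l) \<omega>)) \<in> borel_measurable M"
  by (intro measurable_path_max occurs_measurable) auto

text \<open>
  A union bound over the rare letter, the common letter that replaces it, and the interval.
\<close>

lemma rare_letters_tail:
  assumes j: "strict_mono_on {1..k} j" "j ` {1..k} \<subseteq> {1..m}" "1 \<le> k"
    and q: "\<And>l. l \<in> {1..k} \<Longrightarrow> p (j l) = q"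
    and rare: "\<And>r. r \<in> {1..m} - j ` {1..k} \<Longrightarrow> 0 < p r \<and> p r < q"
  shows "\<exists>\<kappa>>0. \<forall>n D. 0 \<le> D \<longrightarrow> prob {\<omega> \<in> space M. path_max n k (\<lambda>i l. occurs i (j l) \<omega>) + real m * D < path_max n m (\<lambda>i r. occurs i r \<omega>)}
       \<le> real m * real k * (real n + 1)\<^sup>2 * exp (- \<kappa> * D)"
proof -
  define R where "R = {1..m} - j ` {1..k}"
  \<comment> \<open>The 1 keeps the minimum positive and defined when all letters have maximal probability.\<close>
  define \<kappa> where "\<kappa> = Min (insert 1 ((\<lambda>r. ln (q / p r)) ` R))"
  have "0 < ln (q / p r)" if "r \<in> R" for r
    using rare[of r] that by (intro ln_gt_zero) (simp_all add: R_def)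
  then have \<kappa>_pos: "0 < \<kappa>" unfolding \<kappa>_def by (subst Min_gr_iff) (auto simp: R_def)
  have \<kappa>_le: "\<kappa> \<le> ln (q / p r)" if "r \<in> R" for r
    unfolding \<kappa>_def using that by (intro Min_le) (auto simp: R_def)
  have "prob {\<omega> \<in> space M. path_max n k (\<lambda>i l. occurs i (j l) \<omega>) + real m * D < path_max n m (\<lambda>i r. occurs i r \<omega>)}
       \<le> real m * real k * (real n + 1)\<^sup>2 * exp (- \<kappa> * D)" if D: "0 \<le> D" for n D
  proof -
    define I where "I = R \<times> {1..k} \<times> {0..n} \<times> {0..n}"
    define E where "E = (\<lambda>(r, l, a, b). {\<omega> \<in> space M. D \<le> (\<Sum>i\<in>{a<..b}. occurs i r \<omega> - occurs i (j l) \<omega>)})"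
    have I: "finite I" by (simp add: I_def R_def)
    have E_sets: "E x \<in> sets M" for x
      unfolding E_def by (cases x) simp
    have E_prob: "prob (E x) \<le> exp (- \<kappa> * D)" if "x \<in> I" for x
    proof -
      obtain r l a b where x: "x = (r, l, a, b)" by (cases x) auto
      with that have r: "r \<in> R" and l: "l \<in> {1..k}" by (auto simp: I_def)
      have "r \<in> {1..m}" using r by (simp add: R_def)
      moreover have "j l \<in> {1..m}" using j(2) l by blast
      moreover have "0 < p r" "p r < p (j l)" "\<kappa> \<le> ln (p (j l) / p r)"
        using rare[of r] q[OF l] \<kappa>_le[OF r] r by (auto simp: R_def)
      ultimately have *: "r \<in> {1..m}" "j l \<in> {1..m}" "0 < p r" "p r < p (j l)" "\<kappa> \<le> ln (p (j l) / p r)" .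
      from rare_letter_excess_tail[OF * D] show ?thesis by (simp add: x E_def)
    qed
    have "{\<omega> \<in> space M. path_max n k (\<lambda>i l. occurs i (j l) \<omega>) + real m * D < path_max n m (\<lambda>i r. occurs i r \<omega>)}
        \<subseteq> (\<Union>x\<in>I. E x)"
    proof
      fix \<omega> assume \<omega>: "\<omega> \<in> {\<omega> \<in> space M. path_max n k (\<lambda>i l. occurs i (j l) \<omega>) + real m * D < path_max n m (\<lambda>i r. occurs i r \<omega>)}"
      show "\<omega> \<in> (\<Union>x\<in>I. E x)"
      proof (rule ccontr)
        assume "\<omega> \<notin> (\<Union>x\<in>I. E x)"
        then have no: "\<omega> \<notin> E (r, l, a, b)" if "(r, l, a, b) \<in> I" for r l a b using that by blast
        have "(\<Sum>i\<in>{a<..b}. occurs i r \<omega> - occurs i (j l) \<omega>) \<le> D"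
          if "r \<in> {1..m} - j ` {1..k}" "l \<in> {1..k}" "a \<le> b" "b \<le> n" for r l a b
          using no[of r l a b] that \<omega> by (auto simp: E_def I_def R_def)
        from path_max_le_sublist[where n = n and y = "\<lambda>i r. occurs i r \<omega>", OF j D this] \<omega> show False by simp
      qed
    qed
    then have "prob {\<omega> \<in> space M. path_max n k (\<lambda>i l. occurs i (j l) \<omega>) + real m * D < path_max n m (\<lambda>i r. occurs i r \<omega>)}
        \<le> prob (\<Union>x\<in>I. E x)"
      using I E_sets by (intro finite_measure_mono sets.finite_UN) auto
    also have "\<dots> \<le> (\<Sum>x\<in>I. prob (E x))" by (rule measure_UNION_le[OF I E_sets])
    also have "\<dots> \<le> (\<Sum>x\<in>I. exp (- \<kappa> * D))" by (rule sum_mono[OF E_prob])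
    also have "\<dots> = real (card I) * exp (- \<kappa> * D)" by simp
    also have "\<dots> \<le> real m * real k * (real n + 1)\<^sup>2 * exp (- \<kappa> * D)"
    proof (rule mult_right_mono)
      have "card R \<le> m" using card_mono[of "{1..m}" R] by (simp add: R_def)
      then have "real (card R) * (real k * (real n + 1)\<^sup>2) \<le> real m * (real k * (real n + 1)\<^sup>2)"
        by (intro mult_right_mono) auto
      moreover have "real (card I) = real (card R) * (real k * (real n + 1)\<^sup>2)"
        by (simp add: I_def card_cartesian_product power2_eq_square algebra_simps)
      ultimately show "real (card I) \<le> real m * real k * (real n + 1)\<^sup>2" by (simp only: mult.assoc)
    qed simp
    finally show ?thesis .
  qed
  with \<kappa>_pos show ?thesis by blast
qed

lemma rare_letters_negligible:
  assumes j: "strict_mono_on {1..k} j" "j ` {1..k} \<subseteq> {1..m}" "1 \<le> k"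
    and q: "\<And>l. l \<in> {1..k} \<Longrightarrow> p (j l) = q"
    and rare: "\<And>r. r \<in> {1..m} - j ` {1..k} \<Longrightarrow> 0 < p r \<and> p r < q"
  shows "(\<lambda>n. expectation (\<lambda>\<omega>. cos (\<tau> * ((path_max n m (\<lambda>i r. occurs i r \<omega>) - q * real n) / sqrt (real n)) + \<theta>))
     - expectation (\<lambda>\<omega>. cos (\<tau> * ((path_max n k (\<lambda>i l. occurs i (j l) \<omega>) - q * real n) / sqrt (real n)) + \<theta>))) \<longlonglongrightarrow> 0"
proof -
  obtain \<kappa> where \<kappa>: "0 < \<kappa>" and tail: "\<And>n D. 0 \<le> D \<Longrightarrow> prob {\<omega> \<in> space M. path_max n k (\<lambda>i l. occurs i (j l) \<omega>) + real m * D < path_max n m (\<lambda>i r. occurs i r \<omega>)}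
       \<le> real m * real k * (real n + 1)\<^sup>2 * exp (- \<kappa> * D)"
    using rare_letters_tail[OF j q rare] by blast
  define T where "T n \<omega> = path_max n k (\<lambda>i l. occurs i (j l) \<omega>)" for n \<omega>
  define L where "L n \<omega> = path_max n m (\<lambda>i r. occurs i r \<omega>)" for n \<omega>
  have [measurable]: "T n \<in> borel_measurable M" "L n \<in> borel_measurable M" for n
    unfolding T_def L_def using occurs_path_max_measurable[of n k j] occurs_path_max_measurable[of n m "\<lambda>r. r"] by simp_all
  define u where "u x n = cos (\<tau> * ((x - q * real n) / sqrt (real n)) + \<theta>)" for x n
  \<comment> \<open>Any power below 1/2 is negligible against \<open>sqrt n\<close> and still beats the polynomial union bound.\<close>
  define D where "D n = real n powr (1/4)" for n
  have bound: "\<bar>expectation (\<lambda>\<omega>. u (L n \<omega>) n) - expectation (\<lambda>\<omega>. u (T n \<omega>) n)\<bar>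
      \<le> (\<bar>\<tau>\<bar> * real m) * (real n powr (1/4) / sqrt (real n)) + (2 * (real m * real k)) * ((real n + 1)\<^sup>2 * exp (- \<kappa> * real n powr (1/4)))" for n
  proof -
    define bad where "bad = {\<omega> \<in> space M. T n \<omega> + real m * D n < L n \<omega>}"
    have bad [measurable]: "bad \<in> sets M" unfolding bad_def by measurable
    have I: "integrable M (\<lambda>\<omega>. u (L n \<omega>) n)" "integrable M (\<lambda>\<omega>. u (T n \<omega>) n)"
      unfolding u_def by (auto intro!: integrable_const_bound[of _ 1])
    have D0: "0 \<le> D n" by (simp add: D_def)
    have pw: "\<bar>u (L n \<omega>) n - u (T n \<omega>) n\<bar> \<le> \<bar>\<tau>\<bar> * (real m * D n / sqrt (real n)) + 2 * indicator bad \<omega>"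
      if \<omega>: "\<omega> \<in> space M" for \<omega>
    proof (cases "\<omega> \<in> bad")
      case True
      have "\<bar>u (L n \<omega>) n - u (T n \<omega>) n\<bar> \<le> 2"
        using abs_cos_le_one[of "\<tau> * ((L n \<omega> - q * real n) / sqrt (real n)) + \<theta>"]
          abs_cos_le_one[of "\<tau> * ((T n \<omega> - q * real n) / sqrt (real n)) + \<theta>"] unfolding u_def by linarith
      moreover have "0 \<le> \<bar>\<tau>\<bar> * (real m * D n / sqrt (real n))" using D0 by simp
      ultimately show ?thesis using True by simp
    next
      case False
      have "T n \<omega> \<le> L n \<omega>" unfolding T_def L_def
        by (rule path_max_sublist_le[OF j, where y = "\<lambda>i r. occurs i r \<omega>"])
      then have "\<bar>(L n \<omega> - q * real n) / sqrt (real n) - (T n \<omega> - q * real n) / sqrt (real n)\<bar> \<le> real m * D n / sqrt (real n)"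
        using False \<omega> unfolding diff_divide_distrib[symmetric] by (simp add: bad_def divide_right_mono)
      then have "\<bar>\<tau>\<bar> * \<bar>(L n \<omega> - q * real n) / sqrt (real n) - (T n \<omega> - q * real n) / sqrt (real n)\<bar> \<le> \<bar>\<tau>\<bar> * (real m * D n / sqrt (real n))"
        by (rule mult_left_mono) simp
      with cos_affine_lipschitz[of \<tau> "(L n \<omega> - q * real n) / sqrt (real n)" \<theta> "(T n \<omega> - q * real n) / sqrt (real n)"] False
      show ?thesis unfolding u_def by simp
    qed
    have "\<bar>expectation (\<lambda>\<omega>. u (L n \<omega>) n) - expectation (\<lambda>\<omega>. u (T n \<omega>) n)\<bar> = \<bar>expectation (\<lambda>\<omega>. u (L n \<omega>) n - u (T n \<omega>) n)\<bar>"
      using I by simp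
    also have "\<dots> \<le> expectation (\<lambda>\<omega>. \<bar>u (L n \<omega>) n - u (T n \<omega>) n\<bar>)" by (rule integral_abs_bound)
    also have "\<dots> \<le> expectation (\<lambda>\<omega>. \<bar>\<tau>\<bar> * (real m * D n / sqrt (real n)) + 2 * indicator bad \<omega>)"
      by (rule integral_mono[OF _ _ pw], use I in simp,
        intro Bochner_Integration.integrable_add integrable_const integrable_mult_right integrable_real_indicator bad)
        (simp add: emeasure_eq_measure)
    also have "\<dots> = \<bar>\<tau>\<bar> * (real m * D n / sqrt (real n)) + 2 * prob bad"
      by (subst Bochner_Integration.integral_add)
        (use bad in \<open>auto simp: prob_space emeasure_eq_measure intro!: integrable_real_indicator\<close>)
    also have "prob bad \<le> real m * real k * (real n + 1)\<^sup>2 * exp (- \<kappa> * D n)"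
      unfolding bad_def T_def L_def by (rule tail[OF D0])
    finally show ?thesis by (simp add: D_def ac_simps)
  qed
  have "(\<lambda>n. real n powr (1/4) / sqrt (real n)) \<longlonglongrightarrow> 0" by real_asymp
  moreover have "(\<lambda>n. (real n + 1)\<^sup>2 * exp (- \<kappa> * real n powr (1/4))) \<longlonglongrightarrow> 0" using \<kappa> by real_asymp
  ultimately have "(\<lambda>n. (\<bar>\<tau>\<bar> * real m) * (real n powr (1/4) / sqrt (real n)) + (2 * (real m * real k)) * ((real n + 1)\<^sup>2 * exp (- \<kappa> * real n powr (1/4)))) \<longlonglongrightarrow> 0"
    by (intro tendsto_add_zero tendsto_mult_right_zero)
  then have "(\<lambda>n. expectation (\<lambda>\<omega>. u (L n \<omega>) n) - expectation (\<lambda>\<omega>. u (T n \<omega>) n)) \<longlonglongrightarrow> 0"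
    by (rule Lim_null_comparison[rotated]) (intro always_eventually allI, unfold real_norm_def, rule bound)
  then show ?thesis by (simp add: u_def L_def T_def)
qed

end

section \<open>The Gaussian limit\<close>

text \<open>
  The number \<open>c\<close> with \<open>(I + c J)\<^sup>2 = I - q J\<close>, where \<open>J\<close> is the all-ones matrix of size
  \<open>k\<close>.
\<close>

definition covariance_root_coeff :: "nat \<Rightarrow> real \<Rightarrow> real" where
  "covariance_root_coeff k q = (sqrt (1 - real k * q) - 1) / real k"

lemma covariance_square_root:
  assumes k: "1 \<le> k" and kq: "real k * q \<le> 1" and q: "0 \<le> q" and l: "l \<in> {1..k}" "l' \<in> {1..k}"
  shows "(\<Sum>j=1..k. (sqrt q * (of_bool (l = j) + covariance_root_coeff k q)) * (sqrt q * (of_bool (l' = j) + covariance_root_coeff k q)))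
    = (if l = l' then q else 0) - q\<^sup>2"
proof -
  define c where "c = covariance_root_coeff k q"
  have "real k * c + 1 = sqrt (1 - real k * q)" using k by (simp add: c_def covariance_root_coeff_def)
  then have "(real k * c + 1)\<^sup>2 = 1 - real k * q" using kq by simp
  then have "real k * (real k * c\<^sup>2 + 2 * c) = real k * (- q)" by (simp add: power2_eq_square algebra_simps)
  moreover have "real k \<noteq> 0" using k by simp
  ultimately have c: "real k * c\<^sup>2 + 2 * c = - q" by (metis mult_left_cancel)
  have "(\<Sum>j=1..k. (sqrt q * (of_bool (l = j) + c)) * (sqrt q * (of_bool (l' = j) + c)))
      = (\<Sum>j=1..k. q * ((if j = l then of_bool (l = l') else 0) + c * (if j = l then 1 else 0) + c * (if j = l' then 1 else 0) + c\<^sup>2))"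
  proof (rule sum.cong[OF refl])
    fix j
    have "(sqrt q * (of_bool (l = j) + c)) * (sqrt q * (of_bool (l' = j) + c)) = (sqrt q * sqrt q) * ((of_bool (l = j) + c) * (of_bool (l' = j) + c))"
      by (simp only: ac_simps)
    also have "\<dots> = q * ((if j = l then of_bool (l = l') else 0) + c * (if j = l then 1 else 0) + c * (if j = l' then 1 else 0) + c\<^sup>2)"
      using q by (auto simp: algebra_simps power2_eq_square)
    finally show "(sqrt q * (of_bool (l = j) + c)) * (sqrt q * (of_bool (l' = j) + c))
      = q * ((if j = l then of_bool (l = l') else 0) + c * (if j = l then 1 else 0) + c * (if j = l' then 1 else 0) + c\<^sup>2)" .
  qed
  also have "\<dots> = q * (of_bool (l = l') + c + c + real k * c\<^sup>2)"
    using l by (simp add: sum_distrib_left[symmetric] sum.distrib sum.delta)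
  also have "\<dots> = q * (of_bool (l = l') - q)" using c by (simp add: algebra_simps)
  finally show ?thesis unfolding c_def by (simp add: power2_eq_square right_diff_distrib)
qed

text \<open>
  The term \<open>c \<Sum>\<^sub>j \<Delta>B\<^sup>j\<close> of a step is common to all letters. Along every path it
  telescopes to the endpoint of the Brownian paths.
\<close>

lemma path_max_brownian_steps:
  assumes k: "1 \<le> k" and q: "0 \<le> q" and n: "1 \<le> n" and w0: "\<And>l. l \<in> {1..k} \<Longrightarrow> w l 0 = 0"
  shows "path_max n k (\<lambda>i. \<lambda>l\<in>{1..k}. \<Sum>j=1..k. (sqrt q * (of_bool (l = j) + c)) * (w j (real i / real n) - w j (real (i - 1) / real n)))
    = sqrt q * (path_max n k (\<lambda>i l. w l (real i / real n) - w l (real (i - 1) / real n)) + c * (\<Sum>l=1..k. w l 1))"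
proof -
  define g where "g i l = w l (real i / real n) - w l (real (i - 1) / real n)" for i l
  have "path_max n k (\<lambda>i. \<lambda>l\<in>{1..k}. \<Sum>j=1..k. (sqrt q * (of_bool (l = j) + c)) * g i j)
     = path_max n k (\<lambda>i l. sqrt q * (g i l + c * (\<Sum>j=1..k. g i j)))"
  proof (rule path_max_cong)
    fix i l assume l: "l \<in> {1..k}"
    have "(\<Sum>j=1..k. (sqrt q * (of_bool (l = j) + c)) * g i j) = sqrt q * (\<Sum>j=1..k. (if j = l then g i j else 0) + c * g i j)"
      unfolding sum_distrib_left by (intro sum.cong refl) (auto simp: algebra_simps)
    also have "\<dots> = sqrt q * (g i l + c * (\<Sum>j=1..k. g i j))"
      using l by (simp add: sum.distrib sum_distrib_left[symmetric])
    finally show "(\<lambda>l\<in>{1..k}. \<Sum>j=1..k. (sqrt q * (of_bool (l = j) + c)) * g i j) l = sqrt q * (g i l + c * (\<Sum>j=1..k. g i j))"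
      using l by simp
  qed
  also have "\<dots> = sqrt q * (path_max n k g + (\<Sum>i=1..n. c * (\<Sum>j=1..k. g i j)))"
    by (rule path_max_affine[OF k]) (use q in simp)
  also have "(\<Sum>i=1..n. c * (\<Sum>j=1..k. g i j)) = c * (\<Sum>j=1..k. \<Sum>i=1..n. g i j)"
    unfolding sum_distrib_left[symmetric] by (subst sum.swap) simp
  also have "(\<Sum>j=1..k. \<Sum>i=1..n. g i j) = (\<Sum>j=1..k. w j 1)"
  proof (rule sum.cong[OF refl])
    fix j assume j: "j \<in> {1..k}"
    have "{1..n} = {0<..n}" by auto
    then show "(\<Sum>i=1..n. g i j) = w j 1"
      using sum_increments_telescope[of 0 n "\<lambda>i. w j (real i / real n)"] w0[OF j] n by (simp add: g_def)
  qed
  finally show ?thesis by (simp only: g_def[abs_def])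
qed

text \<open>
  The grid maxima converge for every outcome, which yields measurability of the limit and, by dominated
  convergence, convergence of the expectations.
\<close>

lemma brownian_limit:
  fixes c q \<tau> \<theta> :: real
  assumes "prob_space N" and B: "standard_brownian_motion_dim k N B" and k: "1 \<le> k" and q: "0 \<le> q"
  defines "G \<equiv> \<lambda>\<omega>. sqrt q * (c * (\<Sum>l=1..k. B l 1 \<omega>) + max_increments k (\<lambda>l t. B l t \<omega>))"
  shows "G \<in> borel_measurable N"
    and "(\<lambda>n. \<integral>\<omega>. cos (\<tau> * path_max n k (\<lambda>i. \<lambda>l\<in>{1..k}. \<Sum>j=1..k. (sqrt q * (of_bool (l = j) + c)) *
            (B j (real i / real n) \<omega> - B j (real (i - 1) / real n) \<omega>)) + \<theta>) \<partial>N) \<longlonglongrightarrow> (\<integral>\<omega>. cos (\<tau> * G \<omega> + \<theta>) \<partial>N)"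
proof -
  interpret prob_space N by fact
  have BM: "standard_brownian_motion N (B l)" if "l \<in> {1..k}" for l
    using B that by (simp add: standard_brownian_motion_dim_def)
  have Bm: "B l t \<in> borel_measurable N" if "l \<in> {1..k}" "t \<in> {0..1}" for l t
    using BM[OF that(1)] that(2) by (simp add: standard_brownian_motion_def)
  have B0: "B l 0 \<omega> = 0" and Bc: "continuous_on {0..1} (\<lambda>t. B l t \<omega>)" if "l \<in> {1..k}" "\<omega> \<in> space N" for l \<omega>
    using BM[OF that(1)] that(2) by (auto simp: standard_brownian_motion_def)
  define P where "P n \<omega> = path_max n k (\<lambda>i l. B l (real i / real n) \<omega> - B l (real (i - 1) / real n) \<omega>)" for n \<omega>
  have Pm: "P n \<in> borel_measurable N" for n
    unfolding P_def
  proof (rule measurable_path_max)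
    fix i l assume i: "i \<in> {1..n}" and l: "l \<in> {1..k}"
    have "real i / real n \<in> {0..1}" "real (i - 1) / real n \<in> {0..1}" using i by (auto simp: divide_le_eq_1)
    then show "(\<lambda>\<omega>. B l (real i / real n) \<omega> - B l (real (i - 1) / real n) \<omega>) \<in> borel_measurable N"
      by (intro borel_measurable_diff Bm[OF l])
  qed
  have lim: "(\<lambda>n. P n \<omega>) \<longlonglongrightarrow> max_increments k (\<lambda>l t. B l t \<omega>)" if "\<omega> \<in> space N" for \<omega>
    unfolding P_def using grid_path_max_tendsto_max_increments[OF k, of "\<lambda>l t. B l t \<omega>"] Bc that by simp
  have "(\<lambda>\<omega>. max_increments k (\<lambda>l t. B l t \<omega>)) \<in> borel_measurable N"
    by (rule borel_measurable_LIMSEQ_real[OF lim Pm])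
  moreover have S: "(\<lambda>\<omega>. \<Sum>l=1..k. B l 1 \<omega>) \<in> borel_measurable N"
    by (intro borel_measurable_sum Bm) auto
  ultimately show Gm: "G \<in> borel_measurable N" unfolding G_def by measurable
  define h where "h n \<omega> = sqrt q * (P n \<omega> + c * (\<Sum>l=1..k. B l 1 \<omega>))" for n \<omega>
  have hm [measurable]: "h n \<in> borel_measurable N" for n unfolding h_def using Pm S by measurable
  have "(\<lambda>n. \<integral>\<omega>. cos (\<tau> * h n \<omega> + \<theta>) \<partial>N) \<longlonglongrightarrow> (\<integral>\<omega>. cos (\<tau> * G \<omega> + \<theta>) \<partial>N)"
  proof (rule integral_dominated_convergence[where w = "\<lambda>_. 1"])
    show "AE \<omega> in N. (\<lambda>n. cos (\<tau> * h n \<omega> + \<theta>)) \<longlonglongrightarrow> cos (\<tau> * G \<omega> + \<theta>)"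
    proof (rule AE_I2)
      fix \<omega> assume "\<omega> \<in> space N"
      from lim[OF this] show "(\<lambda>n. cos (\<tau> * h n \<omega> + \<theta>)) \<longlonglongrightarrow> cos (\<tau> * G \<omega> + \<theta>)"
        unfolding h_def G_def by (subst add.commute[of "c * _"]) (intro tendsto_intros)
    qed
  qed (use Gm in auto)
  moreover have "(\<integral>\<omega>. cos (\<tau> * path_max n k (\<lambda>i. \<lambda>l\<in>{1..k}. \<Sum>j=1..k. (sqrt q * (of_bool (l = j) + c)) *
            (B j (real i / real n) \<omega> - B j (real (i - 1) / real n) \<omega>)) + \<theta>) \<partial>N) = (\<integral>\<omega>. cos (\<tau> * h n \<omega> + \<theta>) \<partial>N)"
    if n: "1 \<le> n" for n
  proof (rule Bochner_Integration.integral_cong[OF refl])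
    fix \<omega> assume "\<omega> \<in> space N"
    with path_max_brownian_steps[OF k q n, of "\<lambda>l t. B l t \<omega>" c] B0
    show "cos (\<tau> * path_max n k (\<lambda>i. \<lambda>l\<in>{1..k}. \<Sum>j=1..k. (sqrt q * (of_bool (l = j) + c)) *
            (B j (real i / real n) \<omega> - B j (real (i - 1) / real n) \<omega>)) + \<theta>) = cos (\<tau> * h n \<omega> + \<theta>)"
      by (simp add: h_def P_def)
  qed
  ultimately show "(\<lambda>n. \<integral>\<omega>. cos (\<tau> * path_max n k (\<lambda>i. \<lambda>l\<in>{1..k}. \<Sum>j=1..k. (sqrt q * (of_bool (l = j) + c)) *
            (B j (real i / real n) \<omega> - B j (real (i - 1) / real n) \<omega>)) + \<theta>) \<partial>N) \<longlonglongrightarrow> (\<integral>\<omega>. cos (\<tau> * G \<omega> + \<theta>) \<partial>N)"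
    by (subst tendsto_cong[where g = "\<lambda>n. \<integral>\<omega>. cos (\<tau> * h n \<omega> + \<theta>) \<partial>N"]) (auto intro: eventually_sequentiallyI[of 1])
qed

lemma char_distr_cos:
  assumes "prob_space M" and [measurable]: "f \<in> borel_measurable M"
  shows "char (distr M borel f) t = Complex (\<integral>\<omega>. cos (t * f \<omega> + 0) \<partial>M) (\<integral>\<omega>. cos (t * f \<omega> + (- pi / 2)) \<partial>M)"
proof -
  interpret prob_space M by fact
  have "char (distr M borel f) t = (\<integral>\<omega>. iexp (t * f \<omega>) \<partial>M)"
    unfolding char_def by (rule integral_distr) measurable
  moreover have I: "integrable M (\<lambda>\<omega>. iexp (t * f \<omega>))"
    by (rule integrable_const_bound[of _ 1]) auto
  moreover have "Re (iexp (t * f \<omega>)) = cos (t * f \<omega> + 0)" "Im (iexp (t * f \<omega>)) = cos (t * f \<omega> + (- pi / 2))" for \<omega>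
    by (simp_all add: Re_exp Im_exp cos_diff)
  ultimately show ?thesis
    by (simp only: complex_eq_iff complex.sel integral_Re[OF I, symmetric] integral_Im[OF I, symmetric])
qed

section \<open>Convergence of characteristic functions\<close>

text \<open>
  The error of \<open>path_max_lindeberg\<close> for \<open>\<beta> = n powr (1/8)\<close> and third moments of order
  \<open>n powr (-3/2)\<close>; every power of \<open>\<beta>\<close> below the fourth is beaten by \<open>sqrt n\<close>.
\<close>

lemma lindeberg_error_tendsto_0:
  fixes \<tau> \<rho> :: real
  shows "(\<lambda>n. real n * ((\<bar>\<tau>\<bar> ^ 3 + 6 * \<tau>\<^sup>2 * real n powr (1/8) + 6 * \<bar>\<tau>\<bar> * (real n powr (1/8))\<^sup>2) / 3
      * (real k * (\<rho> * (1 / sqrt (real n)) ^ 3))) + 2 * \<bar>\<tau>\<bar> * (real k * ln (real n + 1) / real n powr (1/8))) \<longlonglongrightarrow> 0"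
proof -
  have "(\<lambda>n. real n * (1 / sqrt (real n)) ^ 3) \<longlonglongrightarrow> 0"
    "(\<lambda>n. real n * (1 / sqrt (real n)) ^ 3 * real n powr (1/8)) \<longlonglongrightarrow> 0"
    "(\<lambda>n. real n * (1 / sqrt (real n)) ^ 3 * (real n powr (1/8))\<^sup>2) \<longlonglongrightarrow> 0"
    "(\<lambda>n. ln (real n + 1) / real n powr (1/8)) \<longlonglongrightarrow> 0"
    by real_asymp+
  then have "(\<lambda>n. (\<bar>\<tau>\<bar> ^ 3 * real k * \<rho> / 3) * (real n * (1 / sqrt (real n)) ^ 3)
      + (2 * \<tau>\<^sup>2 * real k * \<rho>) * (real n * (1 / sqrt (real n)) ^ 3 * real n powr (1/8))
      + (2 * \<bar>\<tau>\<bar> * real k * \<rho>) * (real n * (1 / sqrt (real n)) ^ 3 * (real n powr (1/8))\<^sup>2)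
      + (2 * \<bar>\<tau>\<bar> * real k) * (ln (real n + 1) / real n powr (1/8))) \<longlonglongrightarrow> 0"
    by (intro tendsto_add_zero tendsto_mult_right_zero)
  moreover have "real n * ((\<bar>\<tau>\<bar> ^ 3 + 6 * \<tau>\<^sup>2 * y + 6 * \<bar>\<tau>\<bar> * y\<^sup>2) / 3 * (real k * (\<rho> * z))) + 2 * \<bar>\<tau>\<bar> * (real k * w / y)
     = (\<bar>\<tau>\<bar> ^ 3 * real k * \<rho> / 3) * (real n * z) + (2 * \<tau>\<^sup>2 * real k * \<rho>) * (real n * z * y)
      + (2 * \<bar>\<tau>\<bar> * real k * \<rho>) * (real n * z * y\<^sup>2) + (2 * \<bar>\<tau>\<bar> * real k) * (w / y)" for n y z w
    by (simp add: field_simps)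
  ultimately show ?thesis by (simp only:)
qed

text \<open>
  Both families of steps have the covariance \<open>q (I - q J) / n\<close> and third moments of order
  \<open>n powr (-3/2)\<close>.
\<close>

lemma (in iid_letters) max_probability_letters_vs_brownian:
  assumes j: "strict_mono_on {1..k} j" "j ` {1..k} \<subseteq> {1..m}" and k: "1 \<le> k"
    and q: "\<And>l. l \<in> {1..k} \<Longrightarrow> p (j l) = q" "0 \<le> q" and kq: "real k * q \<le> 1"
    and N: "prob_space N" "standard_brownian_motion_dim k N B"
  shows "(\<lambda>n. expectation (\<lambda>\<omega>. cos (\<tau> * ((path_max n k (\<lambda>i l. occurs i (j l) \<omega>) - q * real n) / sqrt (real n)) + \<theta>))
     - (\<integral>\<omega>. cos (\<tau> * path_max n k (\<lambda>i. \<lambda>l\<in>{1..k}. \<Sum>j=1..k. (sqrt q * (of_bool (l = j) + covariance_root_coeff k q)) *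
            (B j (real i / real n) \<omega> - B j (real (i - 1) / real n) \<omega>)) + \<theta>) \<partial>N)) \<longlonglongrightarrow> 0"
proof -
  define a where "a l j = sqrt q * (of_bool (l = j) + covariance_root_coeff k q)" for l j :: nat
  define K where "K = sqrt q * (1 + \<bar>covariance_root_coeff k q\<bar>)"
  have K: "\<bar>a l j\<bar> \<le> K" for l j
    unfolding a_def K_def abs_mult using q(2) by (intro mult_mono) (auto intro: order_trans[OF abs_triangle_ineq])
  have K0: "0 \<le> K" using q(2) by (simp add: K_def)
  have "real 1 * q \<le> real k * q" using k q(2) by (intro mult_right_mono) auto
  then have q1: "q \<le> 1" using kq by simp
  \<comment> \<open>Dominates both third moments: 1 for the letters, the rest for the Gaussian steps.\<close>
  define \<rho> where "\<rho> = 1 + K ^ 3 * real k ^ 3 * (real k * 2)"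
  define Y where "Y n i \<omega> = (\<lambda>l\<in>{1..k}. (occurs i (j l) \<omega> - q) / sqrt (real n))" for n i \<omega>
  define Z where "Z n i \<omega> = (\<lambda>l\<in>{1..k}. \<Sum>j=1..k. a l j * (B j (real i / real n) \<omega> - B j (real (i - 1) / real n) \<omega>))" for n i \<omega>
  define C where "C n l l' = ((if l = l' then q else 0) - q\<^sup>2) / real n" for n l l' :: nat
  let ?R = "PiM {1..k} (\<lambda>_. borel) :: (nat \<Rightarrow> real) measure"
  have bound: "\<bar>expectation (\<lambda>\<omega>. cos (\<tau> * path_max n k (\<lambda>i. Y n i \<omega>) + \<theta>)) - (\<integral>\<omega>. cos (\<tau> * path_max n k (\<lambda>i. Z n i \<omega>) + \<theta>) \<partial>N)\<bar>
     \<le> real n * ((\<bar>\<tau>\<bar> ^ 3 + 6 * \<tau>\<^sup>2 * real n powr (1/8) + 6 * \<bar>\<tau>\<bar> * (real n powr (1/8))\<^sup>2) / 3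
      * (real k * (\<rho> * (1 / sqrt (real n)) ^ 3))) + 2 * \<bar>\<tau>\<bar> * (real k * ln (real n + 1) / real n powr (1/8))"
    if n: "1 \<le> n" for n
  proof (rule path_max_lindeberg[where C = "C n"])
    note Ys = letter_step_vectors[where q = q, OF j _ q(2) q1 n, folded Y_def]
    note Zs = brownian_step_vectors[OF N k n, of a K, OF K, folded Z_def]
    show "prob_space M" "prob_space N" by (fact prob_space_axioms, fact N(1))
    show "indep_vars (\<lambda>_. ?R) (Y n) {1..n}" using Ys(1) q(1) by (simp add: Y_def[abs_def])
    show "prob_space.indep_vars N (\<lambda>_. ?R) (Z n) {1..n}" using Zs(1) by (simp add: Z_def[abs_def])
    have s: "0 \<le> (1 / sqrt (real n)) ^ 3" by simp
    show "step_law k (C n) (\<rho> * (1 / sqrt (real n)) ^ 3) (distr M ?R (Y n i))" if "i \<in> {1..n}" for i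
    proof (rule step_law_mono)
      show "step_law k (\<lambda>l l'. ((if l = l' then q else 0) - q\<^sup>2) / real n) ((1 / sqrt (real n)) ^ 3) (distr M ?R (Y n i))"
        using Ys(2)[OF _ that] q(1) by (simp add: Y_def[abs_def])
      have "1 * (1 / sqrt (real n)) ^ 3 \<le> \<rho> * (1 / sqrt (real n)) ^ 3"
        by (rule mult_right_mono[OF _ s]) (use K0 in \<open>simp add: \<rho>_def\<close>)
      then show "(1 / sqrt (real n)) ^ 3 \<le> \<rho> * (1 / sqrt (real n)) ^ 3" by simp
    qed (simp add: C_def)
    show "step_law k (C n) (\<rho> * (1 / sqrt (real n)) ^ 3) (distr N ?R (Z n i))" if "i \<in> {1..n}" for i
    proof (rule step_law_mono)
      show "step_law k (\<lambda>l l'. (1 / real n) * (\<Sum>j=1..k. a l j * a l' j))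
          (K ^ 3 * real k ^ 3 * (real k * (2 * (1 / sqrt (real n)) ^ 3))) (distr N ?R (Z n i))"
        using Zs(2)[OF that] by (simp add: Z_def[abs_def])
      show "K ^ 3 * real k ^ 3 * (real k * (2 * (1 / sqrt (real n)) ^ 3)) \<le> \<rho> * (1 / sqrt (real n)) ^ 3"
        using s by (simp add: \<rho>_def algebra_simps)
      show "(1 / real n) * (\<Sum>j=1..k. a l j * a l' j) = C n l l'" if "l \<in> {1..k}" "l' \<in> {1..k}" for l l'
        using covariance_square_root[OF k kq q(2) that] by (simp add: a_def C_def)
    qed
    show "0 < real n powr (1/8)" using n by simp
  qed (use n k in auto)
  have "path_max n k (\<lambda>i. Y n i \<omega>) = (path_max n k (\<lambda>i l. occurs i (j l) \<omega>) - q * real n) / sqrt (real n)" for n \<omega>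
  proof -
    have "path_max n k (\<lambda>i. Y n i \<omega>) = path_max n k (\<lambda>i l. (1 / sqrt (real n)) * (occurs i (j l) \<omega> + - q))"
      by (rule path_max_cong) (simp add: Y_def)
    also have "\<dots> = (1 / sqrt (real n)) * (path_max n k (\<lambda>i l. occurs i (j l) \<omega>) + (\<Sum>i=1..n. - q))"
      by (rule path_max_affine[OF k]) simp
    finally show ?thesis by (simp add: mult.commute)
  qed
  moreover have "(\<lambda>n. expectation (\<lambda>\<omega>. cos (\<tau> * path_max n k (\<lambda>i. Y n i \<omega>) + \<theta>)) - (\<integral>\<omega>. cos (\<tau> * path_max n k (\<lambda>i. Z n i \<omega>) + \<theta>) \<partial>N)) \<longlonglongrightarrow> 0"
    by (rule Lim_null_comparison[OF _ lindeberg_error_tendsto_0[of \<tau> k \<rho>]])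
      (rule eventually_sequentiallyI[of 1], unfold real_norm_def, rule bound)
  ultimately show ?thesis by (simp only: Z_def a_def)
qed

theorem corollary3p3:
  fixes M :: "'a measure" and N :: "'b measure"
    and X :: "nat \<Rightarrow> 'a \<Rightarrow> 'c::linorder"
    and \<alpha> :: "nat \<Rightarrow> 'c"
    and p :: "nat \<Rightarrow> real" and pmax :: real
    and j :: "nat \<Rightarrow> nat" and m k :: nat
    and B :: "nat \<Rightarrow> real \<Rightarrow> 'b \<Rightarrow> real"
  assumes "prob_space M"
    and "strict_mono_on {1..m} \<alpha>"
    and "prob_space.indep_vars M (\<lambda>_. count_space (\<alpha> ` {1..m})) X {1..}"
    and "\<And>i. i \<ge> 1 \<Longrightarrow> distr M (count_space (\<alpha> ` {1..m})) (X i) = distr M (count_space (\<alpha> ` {1..m})) (X 1)"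
    and "\<And>r. r \<in> {1..m} \<Longrightarrow> measure M {\<omega> \<in> space M. X 1 \<omega> = \<alpha> r} = p r"
    and "\<And>r. r \<in> {1..m} \<Longrightarrow> 0 < p r \<and> p r < 1"
    and "(\<Sum>r=1..m. p r) = 1"
    and "pmax = Max (p ` {1..m})"
    and "1 \<le> k" and "k \<le> m"
    and "strict_mono_on {1..k} j" and "j ` {1..k} \<subseteq> {1..m}"
    and "\<And>i. i \<in> {1..k} \<Longrightarrow> p (j i) = pmax"
    and "\<And>r. r \<in> {1..m} - j ` {1..k} \<Longrightarrow> p r < pmax"
    and "prob_space N"
    and "standard_brownian_motion_dim k N B"
  shows "weak_conv_m
    (\<lambda>n. distr M borel
       (\<lambda>\<omega>. (real (longest_increasing (\<lambda>i. X i \<omega>) n) - pmax * real n) / sqrt (real n)))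
    (distr N borel
       (\<lambda>\<omega>. sqrt pmax *
          ((sqrt (1 - real k * pmax) - 1) / real k * (\<Sum>i=1..k. B i 1 \<omega>)
           + max_increments k (\<lambda>l t. B l t \<omega>))))"
proof -
  interpret M: prob_space M by fact
  interpret N: prob_space N by fact
  have law: "measure M {\<omega> \<in> space M. X i \<omega> = \<alpha> r} = p r" if i: "1 \<le> i" and r: "r \<in> {1..m}" for i r
  proof -
    have X: "X i \<in> measurable M (count_space (\<alpha> ` {1..m}))" if "1 \<le> i" for i
      using assms(3) that by (auto simp: M.indep_vars_def)
    have "measure M {\<omega> \<in> space M. X i \<omega> = \<alpha> r} = measure (distr M (count_space (\<alpha> ` {1..m})) (X i)) {\<alpha> r}" if "1 \<le> i" for i
      using r by (subst measure_distr[OF X[OF that]]) (auto intro!: arg_cong[of _ _ "measure M"])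
    from this[OF i] this[of 1] show ?thesis using assms(4)[OF i] assms(5)[OF r] by simp
  qed
  interpret iid_letters M X \<alpha> p m
    by (intro iid_letters.intro iid_letters_axioms.intro assms(1-3) law)
  have m: "1 \<le> m" using assms(9,10) by simp
  have pmax: "0 < pmax"
    using assms(6)[of "j 1"] assms(13)[of 1] assms(9) assms(12) by (auto simp: image_subset_iff)
  have kp: "real k * pmax \<le> 1"
  proof -
    have "real k * pmax = (\<Sum>l=1..k. p (j l))" using assms(13) by simp
    also have "\<dots> = (\<Sum>r\<in>j ` {1..k}. p r)"
      using strict_mono_on_imp_inj_on[OF assms(11)] by (simp add: sum.reindex)
    also have "\<dots> \<le> (\<Sum>r=1..m. p r)"
      by (rule sum_mono2) (use assms(12) assms(6) in \<open>auto intro: less_imp_le\<close>)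
    finally show ?thesis using assms(7) by simp
  qed
  define c where "c = covariance_root_coeff k pmax"
  define L where "L n \<omega> = (real (longest_increasing (\<lambda>i. X i \<omega>) n) - pmax * real n) / sqrt (real n)" for n \<omega>
  define L' where "L' n \<omega> = (path_max n m (\<lambda>i r. occurs i r \<omega>) - pmax * real n) / sqrt (real n)" for n \<omega>
  define G where "G \<omega> = sqrt pmax * (c * (\<Sum>i=1..k. B i 1 \<omega>) + max_increments k (\<lambda>l t. B l t \<omega>))" for \<omega>
  have LL': "L n \<omega> = L' n \<omega>" if "\<omega> \<in> space M" for n \<omega>
  proof -
    have "(\<lambda>i. X i \<omega>) ` {1..n} \<subseteq> \<alpha> ` {1..m}" using letter_in_alphabet[OF _ that] by auto
    from longest_increasing_eq_path_max[OF assms(2) this m] show ?thesis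
      by (simp add: L_def L'_def occurs_def)
  qed
  have L'm: "L' n \<in> borel_measurable M" for n
    unfolding L'_def using occurs_path_max_measurable[of n m "\<lambda>r. r"] by simp
  have Lm: "L n \<in> borel_measurable M" for n
    using L'm[of n] by (simp add: LL' cong: measurable_cong)
  have Gm: "G \<in> borel_measurable N"
    using brownian_limit(1)[OF assms(15,16,9), of pmax c] pmax by (simp add: G_def[abs_def])
  have conv: "(\<lambda>n. \<integral>\<omega>. cos (\<tau> * L n \<omega> + \<theta>) \<partial>M) \<longlonglongrightarrow> (\<integral>\<omega>. cos (\<tau> * G \<omega> + \<theta>) \<partial>N)" for \<tau> \<theta>
  proof -
    have rare: "0 < p r \<and> p r < pmax" if "r \<in> {1..m} - j ` {1..k}" for r
      using assms(6)[of r] assms(14)[OF that] that by auto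
    have "(\<integral>\<omega>. cos (\<tau> * L n \<omega> + \<theta>) \<partial>M) = (\<integral>\<omega>. cos (\<tau> * L' n \<omega> + \<theta>) \<partial>M)" for n
      by (rule Bochner_Integration.integral_cong[OF refl]) (simp add: LL')
    moreover have "(\<lambda>n. \<integral>\<omega>. cos (\<tau> * L' n \<omega> + \<theta>) \<partial>M) \<longlonglongrightarrow> (\<integral>\<omega>. cos (\<tau> * G \<omega> + \<theta>) \<partial>N)"
    proof -
      define T where "T n \<omega> = (path_max n k (\<lambda>i l. occurs i (j l) \<omega>) - pmax * real n) / sqrt (real n)" for n \<omega>
      define H where "H n \<omega> = path_max n k (\<lambda>i. \<lambda>l\<in>{1..k}. \<Sum>j=1..k. (sqrt pmax * (of_bool (l = j) + c)) *
            (B j (real i / real n) \<omega> - B j (real (i - 1) / real n) \<omega>))" for n \<omega>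
      have "(\<lambda>n. (\<integral>\<omega>. cos (\<tau> * L' n \<omega> + \<theta>) \<partial>M) - (\<integral>\<omega>. cos (\<tau> * T n \<omega> + \<theta>) \<partial>M)) \<longlonglongrightarrow> 0"
        unfolding L'_def T_def by (rule rare_letters_negligible[OF assms(11,12,9) assms(13) rare])
      moreover have "(\<lambda>n. (\<integral>\<omega>. cos (\<tau> * T n \<omega> + \<theta>) \<partial>M) - (\<integral>\<omega>. cos (\<tau> * H n \<omega> + \<theta>) \<partial>N)) \<longlonglongrightarrow> 0"
        unfolding T_def H_def c_def
        by (rule max_probability_letters_vs_brownian[OF assms(11,12,9) assms(13) _ kp assms(15,16)]) (use pmax in auto)
      moreover have "(\<lambda>n. \<integral>\<omega>. cos (\<tau> * H n \<omega> + \<theta>) \<partial>N) \<longlonglongrightarrow> (\<integral>\<omega>. cos (\<tau> * G \<omega> + \<theta>) \<partial>N)"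
        unfolding H_def G_def by (rule brownian_limit(2)[OF assms(15,16,9)]) (use pmax in auto)
      ultimately show ?thesis using tendsto_add[OF tendsto_add] by fastforce
    qed
    ultimately show ?thesis by simp
  qed
  have "weak_conv_m (\<lambda>n. distr M borel (L n)) (distr N borel G)"
  proof (rule levy_continuity)
    show "real_distribution (distr M borel (L n))" for n by (rule M.real_distribution_distr[OF Lm])
    show "real_distribution (distr N borel G)" by (rule N.real_distribution_distr[OF Gm])
    show "(\<lambda>n. char (distr M borel (L n)) t) \<longlonglongrightarrow> char (distr N borel G) t" for t
      unfolding char_distr_cos[OF assms(1) Lm] char_distr_cos[OF assms(15) Gm]
      by (rule tendsto_Complex[OF conv conv])
  qed
  then show ?thesis
    by (simp only: L_def[abs_def] G_def[abs_def] c_def covariance_root_coeff_def)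
qed

end
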